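(* Let $K(x,y) := \max(1+xy, 0)$ for $(x,y) \in \mathbb{R}\times\mathbb{R}$ (the Jain--Karlin--Schoenberg kernel). Fix an integer $p \geq 2$ and a scalar $\alpha \geq 0$. \begin{enumerate} \item If $\alpha \geq p-2$, then $K^\alpha$ is $\mathrm{TN}_p$ on $\mathbb{R}\times\mathbb{R}$. \item If $K^\alpha$ is $\mathrm{TN}_p$ on $\mathbb{R}\times\mathbb{R}$, then $\alpha \in \mathbb{Z}^{\geq 0}\cup[p-2,\infty)$. More strongly, for all $\mathbf{x},\mathbf{y} \in \operatorname{inc}(\mathbb{R},p)$ with $1 + x_j y_k > 0$ for all $j,k$, the matrix $((1+x_jy_k)^\alpha)_{j,k=1}^p$ is (a) $\mathrm{TP}$ if $\alpha > p-2$; (b) $\mathrm{TN}$ if $\alpha \in \{0,1,\dots,p-2\}$; (c) not $\mathrm{TN}$ if $\alpha \in (0,p-2)\setminus\mathbb{Z}$. \item Let $I \subset \mathbb{R}$ be an interval of positive length with $I \subset [0,\infty)$ or $I \subset (-\infty,0]$. Then $K^\alpha$ restricted to $I \times \mathbb{R}$ (equivalently, to $\mathbb{R} \times I$) is $\mathrm{TN}_p$ if and only if $\alpha \in \mathbb{Z}^{\geq 0}\cup[p-2,\infty)$. In particular, for $\alpha\in\mathbb{Z}^{\ge0}$ these restrictions of $K^\alpha$ are $\mathrm{TN}$. \end{enumerate}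
   Context: For a totally ordered set $X$ and integer $r \geq 1$, $\operatorname{inc}(X,r)$ denotes the set of $r$-tuples $(x_1,\dots,x_r) \in X^r$ with $x_1 < \cdots < x_r$. For $X,Y \subset \mathbb{R}$, a kernel $K : X \times Y \to \mathbb{R}$ is $\mathrm{TN}_p$ if $\det (K(x_j,y_k))_{j,k=1}^r \geq 0$ for all $1 \leq r \leq p$ and all $\mathbf{x} \in \operatorname{inc}(X,r)$, $\mathbf{y} \in \operatorname{inc}(Y,r)$; $\mathrm{TN}$ if $\mathrm{TN}_p$ for all $p$. A real matrix is $\mathrm{TN}$/$\mathrm{TP}$ if all its minors are $\ge0$/$>0$. $K^\alpha$ means $(x,y)\mapsto K(x,y)^\alpha$. Convention: $0^0 := 0$. *)

theory Defs
  imports "HOL-Analysis.Analysis"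
begin

definition JKS :: "real \<Rightarrow> real \<Rightarrow> real" where
  "JKS x y = max (1 + x * y) 0"

text \<open>Power of a kernel, with the convention 0^0 := 0 (Isabelle's powr already
  satisfies 0 powr a = 0 for all a, and u powr a is the usual power for u > 0).\<close>
definition kpow :: "(real \<Rightarrow> real \<Rightarrow> real) \<Rightarrow> real \<Rightarrow> real \<Rightarrow> real \<Rightarrow> real" where
  "kpow K \<alpha> x y = K x y powr \<alpha>"

definition inc :: "real set \<Rightarrow> nat \<Rightarrow> (nat \<Rightarrow> real) \<Rightarrow> bool" where
  "inc X r x \<longleftrightarrow> (\<forall>i<r. x i \<in> X) \<and> (\<forall>i j. i < j \<and> j < r \<longrightarrow> x i < x j)"

definition detf :: "nat \<Rightarrow> (nat \<Rightarrow> nat \<Rightarrow> real) \<Rightarrow> real" where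
  "detf r M = (\<Sum>\<sigma> | \<sigma> permutes {..<r}. of_int (sign \<sigma>) * (\<Prod>i<r. M i (\<sigma> i)))"

definition TN_kernel :: "nat \<Rightarrow> real set \<Rightarrow> real set \<Rightarrow> (real \<Rightarrow> real \<Rightarrow> real) \<Rightarrow> bool" where
  "TN_kernel p X Y K \<longleftrightarrow>
     (\<forall>r. 1 \<le> r \<and> r \<le> p \<longrightarrow> (\<forall>x y. inc X r x \<and> inc Y r y \<longrightarrow>
        detf r (\<lambda>j k. K (x j) (y k)) \<ge> 0))"

definition TN_kernel_all :: "real set \<Rightarrow> real set \<Rightarrow> (real \<Rightarrow> real \<Rightarrow> real) \<Rightarrow> bool" where
  "TN_kernel_all X Y K \<longleftrightarrow> (\<forall>p. TN_kernel p X Y K)"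

definition inc_idx :: "nat \<Rightarrow> nat \<Rightarrow> (nat \<Rightarrow> nat) \<Rightarrow> bool" where
  "inc_idx n r a \<longleftrightarrow> (\<forall>i<r. a i < n) \<and> (\<forall>i j. i < j \<and> j < r \<longrightarrow> a i < a j)"

definition TN_matrix :: "nat \<Rightarrow> (nat \<Rightarrow> nat \<Rightarrow> real) \<Rightarrow> bool" where
  "TN_matrix n M \<longleftrightarrow> (\<forall>r a b. 1 \<le> r \<and> r \<le> n \<and> inc_idx n r a \<and> inc_idx n r b \<longrightarrow>
      detf r (\<lambda>j k. M (a j) (b k)) \<ge> 0)"

definition TP_matrix :: "nat \<Rightarrow> (nat \<Rightarrow> nat \<Rightarrow> real) \<Rightarrow> bool" where
  "TP_matrix n M \<longleftrightarrow> (\<forall>r a b. 1 \<le> r \<and> r \<le> n \<and> inc_idx n r a \<and> inc_idx n r b \<longrightarrow>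
      detf r (\<lambda>j k. M (a j) (b k)) > 0)"

end

theory Submission
  imports Defs "Jordan_Normal_Form.Determinant"
begin

text \<open>All determinants are treated by one induction that lowers the size \<open>r\<close> and the exponent \<open>\<alpha>\<close>
  by one. Dividing row \<open>j\<close> by its first entry turns \<open>1 + x\<^sub>j y\<^sub>k\<close> into \<open>1 + t\<^sub>j s\<^sub>k\<close> with
  \<open>t\<^sub>j = x\<^sub>j / (1 + x\<^sub>j y\<^sub>0)\<close> and \<open>s\<^sub>k = y\<^sub>k - y\<^sub>0\<close>; differences of consecutive rows remove the first
  column, and the mean value theorem, applied row by row, replaces them by derivatives, i.e. by the
  same determinant with exponent \<open>\<alpha> - 1\<close>. For positive entries this determines the sign of every
  minor as that of \<open>\<Prod>k<r-1. (\<alpha> - k) ^ (r - 1 - k)\<close>.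

  If entries may vanish, the rows are rescaled to truncated powers \<open>(\<tau> - y)\<^sub>+\<close> for \<open>x < 0\<close> and
  \<open>(y - \<tau>)\<^sub>+\<close> for \<open>x > 0\<close>, where \<open>\<tau> = - 1 / x\<close>. This class is stable under the same reduction, which
  gives nonnegativity for \<open>\<alpha> > r - 2\<close> and, in the limit, for \<open>\<alpha> = r - 2\<close>. If all \<open>x\<close> have the same
  sign, row differences lower \<open>\<alpha>\<close> without lowering \<open>r\<close>, so an integral \<open>\<alpha>\<close> can be brought down to
  \<open>0\<close>, the case of step functions.\<close>

section \<open>Determinants and row differences\<close>

lemma detf_eq_det: "detf n M = Determinant.det (mat n n (\<lambda>(i, j). M i j))"
proof -
  have "(\<Prod>i<n. M i (\<sigma> i)) = (\<Prod>i = 0..<n. mat n n (\<lambda>(i, j). M i j) $$ (i, \<sigma> i))"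
    if "\<sigma> permutes {..<n}" for \<sigma>
  proof -
    have "\<sigma> i < n" if "i < n" for i
      using permutes_in_image[OF \<open>\<sigma> permutes {..<n}\<close>, of i] that by simp
    then show ?thesis by (intro prod.cong) auto
  qed
  then show ?thesis
    unfolding detf_def det_def'[OF mat_carrier] atLeast0LessThan
    by (intro sum.cong refl) (auto simp: atLeast0LessThan)
qed

lemma detf_cong:
  assumes "\<And>i j. i < n \<Longrightarrow> j < n \<Longrightarrow> M i j = N i j"
  shows "detf n M = detf n N"
proof -
  have "mat n n (\<lambda>(i, j). M i j) = mat n n (\<lambda>(i, j). N i j)"
    by (rule eq_matI) (use assms in auto)
  then show ?thesis by (simp add: detf_eq_det)
qed

lemma detf_0 [simp]: "detf 0 M = 1"
  by (simp add: detf_eq_det det_dim_zero)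

lemma detf_1 [simp]: "detf (Suc 0) M = M 0 0"
  by (simp add: detf_eq_det det_single)

lemma detf_transpose: "detf n (\<lambda>i j. M j i) = detf n M"
proof -
  have "transpose_mat (mat n n (\<lambda>(i, j). M i j)) = mat n n (\<lambda>(i, j). M j i)"
    by (rule eq_matI) auto
  then show ?thesis
    using det_transpose[of "mat n n (\<lambda>(i, j). M i j)" n] by (simp add: detf_eq_det)
qed

lemma detf_scale: "detf n (\<lambda>i j. w i * c j * M i j) = (\<Prod>i<n. w i) * (\<Prod>j<n. c j) * detf n M"
proof -
  have "(\<Prod>i<n. w i * c (\<sigma> i) * M i (\<sigma> i)) = (\<Prod>i<n. w i) * (\<Prod>j<n. c j) * (\<Prod>i<n. M i (\<sigma> i))"
    if "\<sigma> permutes {..<n}" for \<sigma>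
    using prod.permute[OF that, of c] by (simp add: prod.distrib o_def)
  then show ?thesis
    unfolding detf_def by (simp add: sum_distrib_left mult_ac)
qed

text \<open>The cofactors along row \<open>i\<close> do not involve row \<open>i\<close>, so one
  list \<open>C\<close> serves all \<open>v\<close>: the determinant is a fixed linear functional of
  a single varying row.\<close>

lemma detf_row_expansion:
  assumes "i < n"
  obtains C where "\<And>v. detf n (M(i := v)) = (\<Sum>k<n. v k * C k)"
proof
  fix v
  define A where "A v = mat n n (\<lambda>(a, b). (M(i := v)) a b)" for v
  have "detf n (M(i := v)) = (\<Sum>k<n. A v $$ (i, k) * cofactor (A v) i k)"
    using laplace_expansion_row[of "A v" n i] assms by (simp add: detf_eq_det A_def)
  also have "\<dots> = (\<Sum>k<n. v k * cofactor (A (M i)) i k)"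
  proof (rule sum.cong[OF refl])
    fix k assume k: "k \<in> {..<n}"
    have "mat_delete (A v) i k = mat_delete (A (M i)) i k"
      by (rule eq_matI) (use assms k in \<open>auto simp: A_def mat_delete_def\<close>)
    then show "A v $$ (i, k) * cofactor (A v) i k = v k * cofactor (A (M i)) i k"
      using assms k by (simp add: A_def cofactor_def)
  qed
  finally show "detf n (M(i := v)) = (\<Sum>k<n. v k * cofactor (A (M i)) i k)" .
qed

lemma detf_zero_row:
  assumes "i < n" "\<And>k. k < n \<Longrightarrow> M i k = 0"
  shows "detf n M = 0"
proof -
  obtain C where "\<And>v. detf n (M(i := v)) = (\<Sum>k<n. v k * C k)"
    using detf_row_expansion[OF assms(1)] by metis
  from this[of "M i"] show ?thesis using assms(2) by simp
qed

lemma detf_zero_col: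
  assumes "k < n" "\<And>i. i < n \<Longrightarrow> M i k = 0"
  shows "detf n M = 0"
  using detf_zero_row[of k n "\<lambda>i j. M j i"] assms detf_transpose[of n M] by auto

lemma detf_unit_col:
  assumes "M 0 0 = 1" "\<And>i. i < n \<Longrightarrow> M (Suc i) 0 = 0"
  shows "detf (Suc n) M = detf n (\<lambda>i j. M (Suc i) (Suc j))"
proof -
  define A where "A = mat (Suc n) (Suc n) (\<lambda>(a, b). M a b)"
  have "detf (Suc n) M = (\<Sum>i<Suc n. A $$ (i, 0) * cofactor A i 0)"
    using laplace_expansion_column[of A "Suc n" 0] by (simp add: detf_eq_det A_def)
  also have "\<dots> = cofactor A 0 0"
    by (subst sum.lessThan_Suc_shift) (use assms in \<open>simp add: A_def\<close>)
  also have "mat_delete A 0 0 = mat n n (\<lambda>(i, j). M (Suc i) (Suc j))"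
    by (rule eq_matI) (auto simp: A_def mat_delete_def)
  then have "cofactor A 0 0 = detf n (\<lambda>i j. M (Suc i) (Suc j))"
    by (simp add: cofactor_def detf_eq_det)
  finally show ?thesis .
qed

section \<open>Row operations by unitriangular matrices\<close>

lemma detf_row_operation:
  assumes "\<And>i. i < n \<Longrightarrow> c i \<noteq> 0 \<Longrightarrow> s i < n"
    and "(\<forall>i<n. c i \<noteq> 0 \<longrightarrow> s i < i) \<or> (\<forall>i<n. c i \<noteq> 0 \<longrightarrow> i < s i)"
  shows "detf n (\<lambda>i k. M i k + c i * M (s i) k) = detf n M"
proof -
  \<comment> \<open>All rows change simultaneously, each by a multiple of an original row, so the
    new matrix is \<open>L * A\<close>. Since \<open>s\<close> points strictly in one direction
    wherever \<open>c\<close> is nonzero, \<open>L\<close> is triangular with unit diagonal.\<close>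
  define L where "L = mat n n (\<lambda>(i, j). (if j = i then 1 else 0) + (if j = s i then c i else 0))"
  define A where "A = mat n n (\<lambda>(a, b). M a b)"
  have car: "L \<in> carrier_mat n n" "A \<in> carrier_mat n n" by (auto simp: L_def A_def)
  have diag: "map (($$) L \<circ> (\<lambda>i. (i, i))) [0..<n] = replicate n 1"
    using assms by (intro nth_equalityI) (auto simp: L_def)
  then have dl: "prod_list (diag_mat L) = 1"
    by (simp add: diag_mat_def L_def o_def)
  have "Determinant.det L = 1"
    using assms(2)
  proof
    assume h: "\<forall>i<n. c i \<noteq> 0 \<longrightarrow> s i < i"
    have "L $$ (i, j) = 0" if "i < j" "j < n" for i j
      using h[rule_format, of i] that by (cases "c i = 0") (auto simp: L_def)
    then show ?thesis using det_lower_triangular[OF _ car(1)] dl by simp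
  next
    assume h: "\<forall>i<n. c i \<noteq> 0 \<longrightarrow> i < s i"
    have "upper_triangular L"
      using h by (auto simp: L_def upper_triangular_def)
    then show ?thesis using det_upper_triangular[OF _ car(1)] dl by simp
  qed
  moreover have "mat n n (\<lambda>(i, k). M i k + c i * M (s i) k) = L * A"
  proof (rule eq_matI)
    fix i k assume "i < dim_row (L * A)" "k < dim_col (L * A)"
    then have ik: "i < n" "k < n" by (auto simp: L_def A_def)
    have "(L * A) $$ (i, k) = (\<Sum>j<n. ((if j = i then 1 else 0) + (if j = s i then c i else 0)) * M j k)"
      using ik by (simp add: L_def A_def scalar_prod_def atLeast0LessThan)
    also have "\<dots> = (\<Sum>j<n. (if j = i then M j k else 0) + (if j = s i then c i * M j k else 0))"
      by (rule sum.cong) (auto simp: distrib_right)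
    also have "\<dots> = M i k + c i * M (s i) k"
      using ik assms(1)[of i] by (auto simp: sum.distrib)
    finally show "mat n n (\<lambda>(i, k). M i k + c i * M (s i) k) $$ (i, k) = (L * A) $$ (i, k)"
      using ik by simp
  qed (auto simp: L_def A_def)
  ultimately show ?thesis
    using det_mult[OF car] by (simp add: detf_eq_det A_def)
qed

lemma detf_eq_rows:
  assumes "i < n" "j < n" "i < j" "\<And>k. k < n \<Longrightarrow> M i k = M j k"
  shows "detf n M = 0"
proof -
  have "detf n M = detf n (\<lambda>a k. M a k + (if a = j then - 1 else 0) * M i k)"
    by (rule detf_row_operation[symmetric]) (use assms in auto)
  also have "\<dots> = 0"
    by (rule detf_zero_row[of j]) (use assms in auto)
  finally show ?thesis .
qed

lemma detf_backward_differences: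
  "detf n (\<lambda>j k. if 0 < j \<and> j < m then M j k - M (j - 1) k else M j k) = detf n M"
proof -
  have "detf n (\<lambda>j k. M j k + (if 0 < j \<and> j < m then - 1 else 0) * M (j - 1) k) = detf n M"
    by (rule detf_row_operation) (auto split: if_splits)
  moreover have "(\<lambda>j k. M j k + (if 0 < j \<and> j < m then - 1 else 0) * M (j - 1) k) =
      (\<lambda>j k. if 0 < j \<and> j < m then M j k - M (j - 1) k else M j k)"
    by (auto simp: fun_eq_iff)
  ultimately show ?thesis by simp
qed

lemma detf_forward_differences:
  "detf n (\<lambda>j k. if m \<le> j \<and> Suc j < n then M j k - M (Suc j) k else M j k) = detf n M"
proof -
  have "detf n (\<lambda>j k. M j k + (if m \<le> j \<and> Suc j < n then - 1 else 0) * M (Suc j) k) = detf n M"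
    by (rule detf_row_operation) (auto split: if_splits)
  moreover have "(\<lambda>j k. M j k + (if m \<le> j \<and> Suc j < n then - 1 else 0) * M (Suc j) k) =
      (\<lambda>j k. if m \<le> j \<and> Suc j < n then M j k - M (Suc j) k else M j k)"
    by (auto simp: fun_eq_iff)
  ultimately show ?thesis by simp
qed

text \<open>Row \<open>Suc n\<close> lies outside the matrix; it is the zero row subtracted from the last one.\<close>
lemma detf_step_column:
  assumes "0 < m" "m \<le> Suc n"
    and col: "\<And>j. j \<le> n \<Longrightarrow> M j 0 = (if j < m then 1 else 0)"
    and last: "\<And>k. M (Suc n) (Suc k) = 0"
  shows "detf (Suc n) M = detf n (\<lambda>j k. if Suc j < m then M (Suc j) (Suc k) - M j (Suc k)
           else M (Suc j) (Suc k) - M (Suc (Suc j)) (Suc k))"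
proof -
  \<comment> \<open>\<open>N\<close> subtracts from the rows with first entry 0 their successors,
    \<open>L\<close> then from the later rows with first entry 1 their predecessors. Row 0 keeps its
    1 and becomes the pivot of column 0.\<close>
  define N where "N j k = (if m \<le> j \<and> Suc j < Suc n then M j k - M (Suc j) k else M j k)" for j k
  define L where "L j k = (if 0 < j \<and> j < m then N j k - N (j - 1) k else N j k)" for j k
  have "detf (Suc n) M = detf (Suc n) L"
    unfolding L_def detf_backward_differences unfolding N_def by (rule detf_forward_differences[symmetric])
  also have "\<dots> = detf n (\<lambda>i j. L (Suc i) (Suc j))"
    by (rule detf_unit_col) (use assms in \<open>auto simp: L_def N_def\<close>)
  also have "\<dots> = detf n (\<lambda>j k. if Suc j < m then M (Suc j) (Suc k) - M j (Suc k)
           else M (Suc j) (Suc k) - M (Suc (Suc j)) (Suc k))"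
  proof (rule detf_cong)
    fix i j assume "i < n" "j < n"
    then show "L (Suc i) (Suc j) = (if Suc i < m then M (Suc i) (Suc j) - M i (Suc j)
           else M (Suc i) (Suc j) - M (Suc (Suc i)) (Suc j))"
      using last[of j] by (cases "Suc i = n") (auto simp: L_def N_def)
  qed
  finally show ?thesis .
qed

lemma detf_row_differences:
  assumes "\<And>k. M n k = 0"
  shows "detf n M = detf n (\<lambda>j k. M j k - M (Suc j) k)"
proof -
  have "detf n (\<lambda>j k. if 0 \<le> j \<and> Suc j < n then M j k - M (Suc j) k else M j k) = detf n M"
    by (rule detf_forward_differences)
  moreover have "detf n (\<lambda>j k. if 0 \<le> j \<and> Suc j < n then M j k - M (Suc j) k else M j k)
      = detf n (\<lambda>j k. M j k - M (Suc j) k)"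
  proof (rule detf_cong)
    fix i j assume "i < n" "j < n"
    then show "(if 0 \<le> i \<and> Suc i < n then M i j - M (Suc i) j else M i j) = M i j - M (Suc i) j"
      using assms[of j] by (cases "Suc i = n") auto
  qed
  ultimately show ?thesis by simp
qed

section \<open>Limits and increments of determinants\<close>

lemma detf_tendsto:
  assumes "\<And>i j. i < n \<Longrightarrow> j < n \<Longrightarrow> ((\<lambda>e. M e i j) \<longlongrightarrow> N i j) F"
  shows "((\<lambda>e. detf n (M e)) \<longlongrightarrow> detf n N) F"
proof -
  have "((\<lambda>e. \<Prod>i<n. M e i (\<sigma> i)) \<longlongrightarrow> (\<Prod>i<n. N i (\<sigma> i))) F" if "\<sigma> permutes {..<n}" for \<sigma>
    by (intro tendsto_prod assms) (use permutes_in_image[OF that] in auto)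
  then show ?thesis
    unfolding detf_def by (intro tendsto_sum tendsto_mult) auto
qed

text \<open>The determinant is linear in each row, so the mean value theorem for the cofactor
  combination of one row yields a single intermediate point common to all its columns. Rows are
  converted one at a time.\<close>

lemma detf_difference_mean_value:
  fixes F F' :: "nat \<Rightarrow> nat \<Rightarrow> real \<Rightarrow> real"
  assumes lu: "\<And>j. j < n \<Longrightarrow> l j < u j"
    and der: "\<And>j k t. j < n \<Longrightarrow> k < n \<Longrightarrow> l j \<le> t \<Longrightarrow> t \<le> u j \<Longrightarrow>
      (F j k has_real_derivative F' j k t) (at t)"
  shows "\<exists>t. (\<forall>j<n. l j < t j \<and> t j < u j) \<and>
    detf n (\<lambda>j k. F j k (u j) - F j k (l j)) = (\<Prod>j<n. u j - l j) * detf n (\<lambda>j k. F' j k (t j))"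
proof -
  define D where "D j k = F j k (u j) - F j k (l j)" for j k
  have "\<exists>t. (\<forall>j<i. l j < t j \<and> t j < u j) \<and>
    detf n D = (\<Prod>j<i. u j - l j) * detf n (\<lambda>j k. if j < i then F' j k (t j) else D j k)"
    if "i \<le> n" for i
    using that
  proof (induction i)
    case 0
    then show ?case by simp
  next
    case (Suc i)
    then obtain t where t: "\<forall>j<i. l j < t j \<and> t j < u j"
      and eq: "detf n D = (\<Prod>j<i. u j - l j) * detf n (\<lambda>j k. if j < i then F' j k (t j) else D j k)"
      by auto
    define M where "M j k = (if j < i then F' j k (t j) else D j k)" for j k
    obtain C where C: "\<And>v. detf n (M(i := v)) = (\<Sum>k<n. v k * C k)"
      using detf_row_expansion[of i n M] Suc.prems by auto
    define \<phi> where "\<phi> s = (\<Sum>k<n. F i k s * C k)" for s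
    have "(\<phi> has_real_derivative (\<Sum>k<n. F' i k s * C k)) (at s)" if "l i \<le> s" "s \<le> u i" for s
      unfolding \<phi>_def
      by (rule DERIV_sum DERIV_cmult_right)+ (use der that Suc.prems in auto)
    then obtain s where s: "l i < s" "s < u i" "\<phi> (u i) - \<phi> (l i) = (u i - l i) * (\<Sum>k<n. F' i k s * C k)"
      using MVT2[of "l i" "u i" \<phi> "\<lambda>s. \<Sum>k<n. F' i k s * C k"] lu[of i] Suc.prems by auto
    have "M(i := D i) = M"
      by (auto simp: M_def fun_eq_iff)
    then have "detf n M = (\<Sum>k<n. D i k * C k)"
      using C[of "D i"] by simp
    also have "\<dots> = \<phi> (u i) - \<phi> (l i)"
      by (simp add: \<phi>_def D_def sum_subtractf left_diff_distrib)
    also have "\<dots> = (u i - l i) * detf n (M(i := \<lambda>k. F' i k s))"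
      using s(3) by (simp add: C)
    also have "M(i := \<lambda>k. F' i k s) = (\<lambda>j k. if j < Suc i then F' j k ((t(i := s)) j) else D j k)"
      by (auto simp: M_def fun_eq_iff less_Suc_eq)
    finally have "detf n D = (\<Prod>j<Suc i. u j - l j) *
        detf n (\<lambda>j k. if j < Suc i then F' j k ((t(i := s)) j) else D j k)"
      using eq unfolding M_def by simp
    moreover have "\<forall>j<Suc i. l j < (t(i := s)) j \<and> (t(i := s)) j < u j"
      using t s by (auto simp: less_Suc_eq)
    ultimately show ?case by blast
  qed
  from this[of n] obtain t where t: "\<forall>j<n. l j < t j \<and> t j < u j"
    and "detf n D = (\<Prod>j<n. u j - l j) * detf n (\<lambda>j k. if j < n then F' j k (t j) else D j k)"
    by auto
  moreover have "detf n (\<lambda>j k. if j < n then F' j k (t j) else D j k) = detf n (\<lambda>j k. F' j k (t j))"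
    by (rule detf_cong) auto
  ultimately show ?thesis
    unfolding D_def by auto
qed

text \<open>Truncated powers may fail to be differentiable at finitely many points, with unbounded
  derivatives nearby. The integral of a nonnegative function therefore replaces the mean value
  theorem, and only the sign is kept.\<close>

lemma detf_difference_nonneg:
  fixes F F' :: "nat \<Rightarrow> nat \<Rightarrow> real \<Rightarrow> real"
  assumes "finite S" and lu: "\<And>j. j < n \<Longrightarrow> l j < u j"
    and cont: "\<And>j k. j < n \<Longrightarrow> k < n \<Longrightarrow> continuous_on {l j..u j} (F j k)"
    and der: "\<And>j k t. j < n \<Longrightarrow> k < n \<Longrightarrow> l j < t \<Longrightarrow> t < u j \<Longrightarrow> t \<notin> S \<Longrightarrow>
      (F j k has_real_derivative F' j k t) (at t)"
    and pos: "\<And>t. (\<And>j. j < n \<Longrightarrow> l j < t j \<and> t j < u j) \<Longrightarrow> detf n (\<lambda>j k. F' j k (t j)) \<ge> 0"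
  shows "detf n (\<lambda>j k. F j k (u j) - F j k (l j)) \<ge> 0"
proof -
  define D where "D j k = F j k (u j) - F j k (l j)" for j k
  \<comment> \<open>The last \<open>d\<close> rows are differences, the others derivatives. All
    \<open>t\<close> are quantified because converting the next row integrates over its
    point.\<close>
  have "\<forall>t. (\<forall>j<n - d. l j < t j \<and> t j < u j) \<longrightarrow>
    detf n (\<lambda>j k. if j < n - d then F' j k (t j) else D j k) \<ge> 0"
    if "d \<le> n" for d
    using that
  proof (induction d)
    case 0
    have "detf n (\<lambda>j k. if j < n then F' j k (t j) else D j k) = detf n (\<lambda>j k. F' j k (t j))" for t
      by (rule detf_cong) auto
    then show ?case using pos by auto
  next
    case (Suc d)
    define i where "i = n - Suc d"
    have i: "i < n" "n - d = Suc i" using Suc.prems by (auto simp: i_def)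
    show ?case
    proof (intro allI impI)
      fix t assume t: "\<forall>j<n - Suc d. l j < t j \<and> t j < u j"
      define M where "M j k = (if j < i then F' j k (t j) else D j k)" for j k
      obtain C where C: "\<And>v. detf n (M(i := v)) = (\<Sum>k<n. v k * C k)"
        using detf_row_expansion[of i n M] i by auto
      define \<phi> where "\<phi> s = (\<Sum>k<n. F i k s * C k)" for s
      define \<psi> where "\<psi> s = (if l i < s \<and> s < u i then \<Sum>k<n. F' i k s * C k else 0)" for s
      have der\<phi>: "(\<phi> has_real_derivative \<psi> s) (at s)" if "s \<in> {l i<..<u i} - S" for s
      proof -
        have "(\<phi> has_real_derivative (\<Sum>k<n. F' i k s * C k)) (at s)"
          unfolding \<phi>_def
          by (rule DERIV_sum DERIV_cmult_right)+ (use der that i in auto)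
        then show ?thesis using that by (simp add: \<psi>_def)
      qed
      have "continuous_on {l i..u i} \<phi>"
        unfolding \<phi>_def by (intro continuous_intros cont) (use i in auto)
      then have int: "(\<psi> has_integral (\<phi> (u i) - \<phi> (l i))) {l i..u i}"
        using fundamental_theorem_of_calculus_interior_strong[OF assms(1), of "l i" "u i" \<phi> \<psi>]
          der\<phi> lu[OF i(1)] by (simp add: has_real_derivative_iff_has_vector_derivative)
      have "\<psi> s \<ge> 0" for s
      proof (cases "l i < s \<and> s < u i")
        case True
        have "M(i := \<lambda>k. F' i k s) = (\<lambda>j k. if j < n - d then F' j k ((t(i := s)) j) else D j k)"
          using i by (auto simp: M_def fun_eq_iff less_Suc_eq)
        moreover have "\<forall>j<n - d. l j < (t(i := s)) j \<and> (t(i := s)) j < u j"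
          using t True i by (auto simp: less_Suc_eq i_def)
        ultimately have "detf n (M(i := \<lambda>k. F' i k s)) \<ge> 0"
          using Suc by auto
        then show ?thesis using True by (simp add: \<psi>_def C)
      qed (auto simp: \<psi>_def)
      then have "\<phi> (u i) - \<phi> (l i) \<ge> 0"
        using has_integral_nonneg[OF int] by auto
      moreover have "M(i := D i) = M"
        by (auto simp: M_def fun_eq_iff)
      then have "detf n M = (\<Sum>k<n. D i k * C k)"
        using C[of "D i"] by simp
      then have "detf n M = \<phi> (u i) - \<phi> (l i)"
        by (simp add: \<phi>_def D_def sum_subtractf left_diff_distrib)
      ultimately have "detf n M \<ge> 0" by simp
      then show "detf n (\<lambda>j k. if j < n - Suc d then F' j k (t j) else D j k) \<ge> 0"
        by (simp add: M_def [abs_def] i_def)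
    qed
  qed
  from this[of n] show ?thesis by (simp add: D_def [abs_def])
qed

section \<open>Minors with positive entries\<close>

text \<open>Up to the positive factors \<open>i!\<close>, this is the product of the binomial coefficients
  \<open>\<alpha> choose i\<close> over \<open>i < n\<close>, the leading coefficient of \<open>det ((1 + x\<^sub>j y\<^sub>k) powr \<alpha>)\<close>
  relative to the two Vandermonde determinants.\<close>
fun binom_sign_coeff :: "nat \<Rightarrow> real \<Rightarrow> real" where
  "binom_sign_coeff 0 \<alpha> = 1"
| "binom_sign_coeff (Suc n) \<alpha> = \<alpha> ^ n * binom_sign_coeff n (\<alpha> - 1)"

text \<open>The factors \<open>\<alpha> - k\<close> with positive exponent have
  \<open>k + 2 \<le> n\<close>, hence are all positive.\<close>

lemma binom_sign_coeff_pos: "\<alpha> > real n - 2 \<Longrightarrow> binom_sign_coeff n \<alpha> > 0"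
proof (induction n arbitrary: \<alpha>)
  case (Suc n)
  then have "binom_sign_coeff n (\<alpha> - 1) > 0" by simp
  \<comment> \<open>For \<open>n = 0\<close> the base may be negative, but the exponent is
    0.\<close>
  moreover have "\<alpha> ^ n > 0"
    using Suc.prems by (cases n) auto
  ultimately show ?case by simp
qed simp

text \<open>The factor \<open>\<alpha> - m\<close> vanishes and has positive exponent
  \<open>n - 1 - m\<close>.\<close>

lemma binom_sign_coeff_zero: "m + 2 \<le> n \<Longrightarrow> binom_sign_coeff n (real m) = 0"
proof (induction n arbitrary: m)
  case (Suc n)
  then show ?case by (cases m) auto
qed simp

text \<open>Size \<open>m + 3\<close> is the first at which the negative factor
  \<open>\<alpha> - (m + 1)\<close> occurs, and it has exponent 1; the factors before it are
  positive.\<close>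

lemma binom_sign_coeff_neg:
  "real m < \<alpha> \<Longrightarrow> \<alpha> < real m + 1 \<Longrightarrow> binom_sign_coeff (m + 3) \<alpha> < 0"
proof (induction m arbitrary: \<alpha>)
  case 0
  then show ?case by (auto simp: numeral_eq_Suc mult_pos_neg)
next
  case (Suc m)
  then have "binom_sign_coeff (m + 3) (\<alpha> - 1) < 0" by simp
  then have "\<alpha> ^ (m + 3) * binom_sign_coeff (m + 3) (\<alpha> - 1) < 0"
    using Suc.prems by (intro mult_pos_neg zero_less_power) auto
  then show ?case by (simp only: add_Suc binom_sign_coeff.simps)
qed

text \<open>One reduction leaves \<open>\<alpha> ^ n\<close> times positive factors times the
  determinant of size \<open>n\<close> with exponent \<open>\<alpha> - 1\<close>, which is the
  recursion of \<open>binom_sign_coeff\<close>.\<close>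

lemma detf_power_sign:
  fixes x y :: "nat \<Rightarrow> real"
  assumes "\<And>i j. i < j \<Longrightarrow> j < n \<Longrightarrow> x i < x j" "\<And>i j. i < j \<Longrightarrow> j < n \<Longrightarrow> y i < y j"
    and "\<And>j k. j < n \<Longrightarrow> k < n \<Longrightarrow> 1 + x j * y k > 0"
  shows "\<exists>D>0. detf n (\<lambda>j k. (1 + x j * y k) powr \<alpha>) = binom_sign_coeff n \<alpha> * D"
  using assms
proof (induction n arbitrary: x y \<alpha>)
  case 0
  show ?case by (intro exI[of _ 1]) simp
next
  case (Suc n)
  note x = Suc.prems(1) and y = Suc.prems(2) and pos = Suc.prems(3)
  define w where "w j = 1 + x j * y 0" for j
  define t where "t j = x j / w j" for j
  define s where "s k = y k - y 0" for k
  have w: "w j > 0" if "j < Suc n" for j using pos[of j 0] that by (simp add: w_def)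
  have fac: "1 + x j * y k = w j * (1 + t j * s k)" if "j < Suc n" for j k
    using w[OF that] by (simp add: t_def s_def field_simps) (simp add: w_def algebra_simps)
  have ts: "1 + t j * s k > 0" if "j < Suc n" "k < Suc n" for j k
    using pos[OF that] w[OF that(1)] by (simp add: fac[OF that(1)] zero_less_mult_iff)
  have s: "s i < s j" if "i < j" "j < Suc n" for i j using y[OF that] by (simp add: s_def)
  have spos: "s (Suc k) > 0" if "k < n" for k using s[of 0 "Suc k"] that by (simp add: s_def)
  have t: "t i < t j" if "i < j" "j < Suc n" for i j
  proof -
    have "t j - t i = (x j - x i) / (w i * w j)"
      using w[of i] w[of j] that by (simp add: t_def divide_simps) (simp add: w_def algebra_simps)
    moreover have "(x j - x i) / (w i * w j) > 0"
      using x[OF that] w[of i] w[of j] that by simp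
    ultimately show ?thesis by linarith
  qed
  define F where "F j k u = (1 + u * s (Suc k)) powr \<alpha>" for j k :: nat and u
  define F' where "F' j k u = \<alpha> * (s (Suc k) * (1 + u * s (Suc k)) powr (\<alpha> - 1))" for j k :: nat and u
  \<comment> \<open>As \<open>s (Suc k) > 0\<close>, the expression increases in \<open>u\<close>
    and stays positive to the right of \<open>t j\<close>.\<close>
  have lin: "1 + u * s (Suc k) > 0" if "j < Suc n" "k < n" "t j \<le> u" for j k u
  proof -
    have "t j * s (Suc k) \<le> u * s (Suc k)"
      using spos[OF that(2)] that(3) by simp
    then show ?thesis using ts[of j "Suc k"] that by simp
  qed
  have "\<exists>\<tau>. (\<forall>j<n. t j < \<tau> j \<and> \<tau> j < t (Suc j)) \<and>
    detf n (\<lambda>j k. F j k (t (Suc j)) - F j k (t j)) = (\<Prod>j<n. t (Suc j) - t j) * detf n (\<lambda>j k. F' j k (\<tau> j))"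
  proof (rule detf_difference_mean_value)
    fix j k u assume "j < n" "k < n" "t j \<le> u" "u \<le> t (Suc j)"
    then have "1 + u * s (Suc k) > 0" using lin[of j k u] by simp
    then show "(F j k has_real_derivative F' j k u) (at u)"
      unfolding F_def F'_def by (auto intro!: derivative_eq_intros)
  qed (use t in auto)
  then obtain \<tau> where \<tau>: "\<And>j. j < n \<Longrightarrow> t j < \<tau> j \<and> \<tau> j < t (Suc j)"
    and eq: "detf n (\<lambda>j k. F j k (t (Suc j)) - F j k (t j)) =
      (\<Prod>j<n. t (Suc j) - t j) * detf n (\<lambda>j k. F' j k (\<tau> j))"
    by blast
  have \<tau>_inc: "\<tau> i < \<tau> j" if "i < j" "j < n" for i j
  proof -
    have "t (Suc i) \<le> t j" using t[of "Suc i" j] that by (cases "Suc i = j") auto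
    then show ?thesis using \<tau>[of i] \<tau>[of j] that by simp
  qed
  have "\<exists>D>0. detf n (\<lambda>j k. (1 + \<tau> j * s (Suc k)) powr (\<alpha> - 1)) = binom_sign_coeff n (\<alpha> - 1) * D"
  proof (rule Suc.IH)
    show "1 + \<tau> j * s (Suc k) > 0" if "j < n" "k < n" for j k
      using lin[of j k "\<tau> j"] \<tau>[of j] that by simp
  qed (use \<tau>_inc s in auto)
  then obtain D where D: "D > 0"
    "detf n (\<lambda>j k. (1 + \<tau> j * s (Suc k)) powr (\<alpha> - 1)) = binom_sign_coeff n (\<alpha> - 1) * D"
    by blast
  \<comment> \<open>Column 0 is constantly 1 because \<open>s 0 = 0\<close>. Row
    \<open>Suc n\<close> lies outside the matrix and is set to 0 to fit
    \<open>detf_step_column\<close>, which is applied with all rows in the first group.\<close>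
  define N where "N j k = (if j = Suc n \<and> k \<noteq> 0 then 0 else (1 + t j * s k) powr \<alpha>)" for j k
  have "detf (Suc n) (\<lambda>j k. (1 + x j * y k) powr \<alpha>) = detf (Suc n) (\<lambda>j k. w j powr \<alpha> * 1 * N j k)"
    by (rule detf_cong) (use w ts in \<open>simp add: fac powr_mult N_def less_imp_le\<close>)
  also have "\<dots> = (\<Prod>j<Suc n. w j powr \<alpha>) * detf (Suc n) N"
    by (subst detf_scale) simp
  also have "detf (Suc n) N = detf n (\<lambda>j k. if Suc j < Suc n then N (Suc j) (Suc k) - N j (Suc k)
           else N (Suc j) (Suc k) - N (Suc (Suc j)) (Suc k))"
    by (rule detf_step_column) (auto simp: N_def s_def)
  also have "\<dots> = detf n (\<lambda>j k. F j k (t (Suc j)) - F j k (t j))"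
    by (rule detf_cong) (auto simp: N_def F_def)
  also have "\<dots> = (\<Prod>j<n. t (Suc j) - t j) * (\<alpha> ^ n * (\<Prod>k<n. s (Suc k)) *
      (binom_sign_coeff n (\<alpha> - 1) * D))"
    unfolding eq D(2)[symmetric] F'_def
    using detf_scale[of n "\<lambda>_. \<alpha>" "\<lambda>k. s (Suc k)" "\<lambda>j k. (1 + \<tau> j * s (Suc k)) powr (\<alpha> - 1)"]
    by (simp add: mult_ac)
  finally have "detf (Suc n) (\<lambda>j k. (1 + x j * y k) powr \<alpha>) = binom_sign_coeff (Suc n) \<alpha> *
      ((\<Prod>j<Suc n. w j powr \<alpha>) * (\<Prod>j<n. t (Suc j) - t j) * (\<Prod>k<n. s (Suc k)) * D)"
    by (simp add: mult_ac)
  moreover have "(\<Prod>j<Suc n. w j powr \<alpha>) * (\<Prod>j<n. t (Suc j) - t j) * (\<Prod>k<n. s (Suc k)) * D > 0"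
    by (intro mult_pos_pos prod_pos D) (use w t spos in \<open>auto simp: less_imp_neq[THEN not_sym]\<close>)
  ultimately show ?case by blast
qed

section \<open>Determinants of truncated powers\<close>

text \<open>The truncated power of exponent \<beta>. For \<open>\<beta> = 0\<close> it is the
  indicator of \<open>u > 0\<close>; exponents between -1 and 0 can occur at the bottom of the
  induction on the size.\<close>

definition tpow :: "real \<Rightarrow> real \<Rightarrow> real" where
  "tpow \<beta> u = max u 0 powr \<beta>"

section \<open>Calculus of truncated powers\<close>

lemma tpow_nonneg [simp]: "tpow \<beta> u \<ge> 0"
  by (simp add: tpow_def)

lemma tpow_of_nonpos [simp]: "u \<le> 0 \<Longrightarrow> tpow \<beta> u = 0"
  by (simp add: tpow_def max_def)

lemma tpow_of_nonneg: "u \<ge> 0 \<Longrightarrow> tpow \<beta> u = u powr \<beta>"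
  by (simp add: tpow_def max_def)

lemma tpow_mult: "c \<ge> 0 \<Longrightarrow> tpow \<beta> (c * u) = c powr \<beta> * tpow \<beta> u"
proof -
  assume "c \<ge> 0"
  then have "max (c * u) 0 = c * max u 0"
    using max_mult_distrib_left[of c u 0] by simp
  with \<open>c \<ge> 0\<close> show ?thesis by (simp add: tpow_def powr_mult)
qed

lemma isCont_tpow: "\<beta> > 0 \<Longrightarrow> isCont (tpow \<beta>) u"
proof -
  assume "\<beta> > 0"
  have "((\<lambda>v. max v 0 powr \<beta>) \<longlongrightarrow> max u 0 powr \<beta>) (at u)"
    by (rule tendsto_powr') (use \<open>\<beta> > 0\<close> in \<open>auto intro!: tendsto_intros\<close>)
  then show ?thesis by (simp add: isCont_def tpow_def [abs_def])
qed

lemma has_real_derivative_tpow: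
  assumes "u \<noteq> 0"
  shows "(tpow \<beta> has_real_derivative \<beta> * tpow (\<beta> - 1) u) (at u)"
proof (cases "u > 0")
  case True
  then have "((\<lambda>u. u powr \<beta>) has_real_derivative \<beta> * tpow (\<beta> - 1) u) (at u)"
    by (auto simp: tpow_of_nonneg intro!: derivative_eq_intros)
  then show ?thesis
    by (rule has_field_derivative_transform_within_open[where S = "{0<..}"])
       (use True in \<open>auto simp: tpow_of_nonneg\<close>)
next
  case False
  have "((\<lambda>u. 0) has_real_derivative \<beta> * tpow (\<beta> - 1) u) (at u)"
    using False by simp
  then show ?thesis
    by (rule has_field_derivative_transform_within_open[where S = "{..<0}"])
       (use False assms in auto)
qed

text \<open>The minus sign in the second part gives left and right rows derivatives of the same
  form, although the two groups are subtracted in opposite order.\<close>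

lemma has_real_derivative_tpow_diff:
  assumes "t \<noteq> z"
  shows "((\<lambda>t. tpow \<beta> (t - z)) has_real_derivative \<beta> * tpow (\<beta> - 1) (t - z)) (at t)"
    and "((\<lambda>t. - tpow \<beta> (z - t)) has_real_derivative \<beta> * tpow (\<beta> - 1) (z - t)) (at t)"
proof -
  have "((\<lambda>t. tpow \<beta> (t - z)) has_real_derivative \<beta> * tpow (\<beta> - 1) (t - z) * 1) (at t)"
    by (rule DERIV_chain2[OF has_real_derivative_tpow]) (use assms in \<open>auto intro!: derivative_eq_intros\<close>)
  then show "((\<lambda>t. tpow \<beta> (t - z)) has_real_derivative \<beta> * tpow (\<beta> - 1) (t - z)) (at t)"
    by simp
  have "((\<lambda>t. tpow \<beta> (z - t)) has_real_derivative \<beta> * tpow (\<beta> - 1) (z - t) * - 1) (at t)"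
    by (rule DERIV_chain2[OF has_real_derivative_tpow]) (use assms in \<open>auto intro!: derivative_eq_intros\<close>)
  then show "((\<lambda>t. - tpow \<beta> (z - t)) has_real_derivative \<beta> * tpow (\<beta> - 1) (z - t)) (at t)"
    using DERIV_minus by fastforce
qed

lemma continuous_on_tpow_diff:
  assumes "\<beta> > 0"
  shows "continuous_on A (\<lambda>t. tpow \<beta> (t - z))" "continuous_on A (\<lambda>t. - tpow \<beta> (z - t))"
  by (intro continuous_at_imp_continuous_on ballI continuous_minus
      isCont_o2[OF _ isCont_tpow] continuous_intros assms)+

text \<open>The rows with negative \<open>x\<close> (\<open>j < m\<close>) and those with positive \<open>x\<close> of the kernel
  \<open>max (1 + x y) 0 powr \<beta>\<close>, rescaled by \<open>\<bar>x\<bar> powr \<beta>\<close>, with \<open>\<tau> = - 1 / x\<close> and \<open>z = y\<close>.\<close>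
definition two_sided :: "real \<Rightarrow> nat \<Rightarrow> (nat \<Rightarrow> real) \<Rightarrow> (nat \<Rightarrow> real) \<Rightarrow> nat \<Rightarrow> nat \<Rightarrow> real" where
  "two_sided \<beta> m \<tau> z j k = (if j < m then tpow \<beta> (\<tau> j - z k) else tpow \<beta> (z k - \<tau> j))"

text \<open>The map is increasing on each half-line but not across 0, which is why left and right
  rows are ordered separately.\<close>

lemma neg_inverse_less:
  fixes a b :: real
  assumes "a < b" "0 < a \<or> b < 0"
  shows "- 1 / a < - 1 / b"
  using assms by (auto simp: divide_simps mult_less_0_iff zero_less_mult_iff)

text \<open>Pivoting at column \<open>0\<close>: the projective map \<open>t \<mapsto> - 1 / (t - z 0)\<close> makes that column \<open>0\<close>/\<open>1\<close> and
  turns the other entries into two-sided ones again, where the right rows with \<open>\<tau> j < z 0\<close> join the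
  left rows at their end. Both groups then allow row differences: the last right row is compared
  with a zero row, that of a \<open>\<tau>\<close> beyond all \<open>\<zeta>\<close>.\<close>
lemma detf_two_sided_step:
  assumes IH: "\<And>m \<tau> z. (\<And>i j. i < j \<Longrightarrow> j < n \<Longrightarrow> j < m \<or> m \<le> i \<Longrightarrow> \<tau> i < \<tau> j) \<Longrightarrow>
      (\<And>i j. i < j \<Longrightarrow> j < n \<Longrightarrow> z i < z j) \<Longrightarrow> detf n (two_sided (\<beta> - 1) m \<tau> z) \<ge> 0"
    and "\<beta> > 0"
    and \<tau>: "\<And>i j. i < j \<Longrightarrow> j < Suc n \<Longrightarrow> j < m \<or> m \<le> i \<Longrightarrow> \<tau> i < \<tau> j"
    and z: "\<And>i j. i < j \<Longrightarrow> j < Suc n \<Longrightarrow> z i < z j"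
    and ne: "\<And>j. j < Suc n \<Longrightarrow> \<tau> j \<noteq> z 0"
  shows "detf (Suc n) (two_sided \<beta> m \<tau> z) \<ge> 0"
proof (cases "\<exists>j<Suc n. j < m \<and> \<tau> j < z 0")
  case True
  then obtain j where j: "j < Suc n" "j < m" "\<tau> j < z 0" by blast
  have "detf (Suc n) (two_sided \<beta> m \<tau> z) = 0"
  proof (rule detf_zero_row[OF j(1)])
    fix k assume "k < Suc n"
    then have "z 0 \<le> z k" using z[of 0 k] by (cases k) auto
    then show "two_sided \<beta> m \<tau> z j k = 0" using j by (simp add: two_sided_def)
  qed
  then show ?thesis by simp
next
  case False
  then have left: "\<tau> j > z 0" if "j < Suc n" "j < m" for j
    using ne[OF that(1)] that by force
  \<comment> \<open>Column 0 is positive exactly in the rows before \<open>m'\<close>: left rows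
    with \<open>\<tau> j > z 0\<close>, then right rows with \<open>\<tau> j < z 0\<close>.\<close>
  define m' where "m' = (LEAST j. j = Suc n \<or> m \<le> j \<and> \<tau> j > z 0)"
  have m'_le: "m' \<le> Suc n" unfolding m'_def by (rule Least_le) simp
  have lo: "j < m \<and> \<tau> j > z 0 \<or> m \<le> j \<and> \<tau> j < z 0" if "j < m'" for j
    using not_less_Least[OF that[unfolded m'_def]] left[of j] ne[of j] m'_le that by force
  have m': "m' = Suc n \<or> m \<le> m' \<and> \<tau> m' > z 0"
    unfolding m'_def by (rule LeastI[of "\<lambda>j. j = Suc n \<or> m \<le> j \<and> \<tau> j > z 0" "Suc n"]) simp
  have hi: "m \<le> j \<and> \<tau> j > z 0" if "m' \<le> j" "j < Suc n" for j
    using m' \<tau>[of m' j] that by (cases "m' = j") auto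
  show ?thesis
  proof (cases "m' = 0")
    case True
    have "detf (Suc n) (two_sided \<beta> m \<tau> z) = 0"
      by (rule detf_zero_col[of 0]) (use hi True in \<open>force simp: two_sided_def\<close>)+
    then show ?thesis by simp
  next
    case False
    \<comment> \<open>The value at the outside index \<open>Suc n\<close> exceeds 0 and
      \<open>T n\<close>; since all \<open>\<zeta>\<close> are negative, that row is zero. The node
      \<open>z 0\<close> goes to infinity and drops out of \<open>\<zeta>\<close>.\<close>
    define T where "T j = (if j = Suc n then max 0 (- 1 / (\<tau> n - z 0)) + 1 else - 1 / (\<tau> j - z 0))" for j
    define \<zeta> where "\<zeta> k = - 1 / (z (Suc k) - z 0)" for k
    have T_inc: "T i < T j" if ij: "i < j" "j \<le> Suc n" and side: "j < m' \<or> m' \<le> i" for i j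
    proof -
      have main: "- 1 / (\<tau> i - z 0) < - 1 / (\<tau> j - z 0)" if jn: "j < Suc n"
      proof (cases "j < m'")
        case True
        \<comment> \<open>In the mixed case \<open>i\<close> is a left and \<open>j\<close> a right
          row: the projective map sends \<open>\<tau> i > z 0\<close> to a negative and
          \<open>\<tau> j < z 0\<close> to a positive number.\<close>
        then consider "\<tau> i > z 0" "\<tau> j < z 0" | "\<tau> i < \<tau> j" "\<tau> i > z 0" | "\<tau> i < \<tau> j" "\<tau> j < z 0"
          using lo[of i] lo[of j] \<tau>[of i j] ij jn by (cases "j < m"; cases "i < m") auto
        then show ?thesis
        proof cases
          case 1
          then have "- 1 / (\<tau> i - z 0) < 0" "- 1 / (\<tau> j - z 0) > 0"
            by (auto simp: divide_simps)
          then show ?thesis by linarith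
        qed (intro neg_inverse_less; simp)+
      next
        case False
        then show ?thesis
          using side hi[of i] hi[of j] \<tau>[of i j] ij that by (intro neg_inverse_less) auto
      qed
      show ?thesis
      proof (cases "j = Suc n")
        case True
        have "T i \<le> T n"
        proof (cases "i = n")
          case False
          then have "m' \<le> i" "i < n" using True side ij m'_le by auto
          then show ?thesis
            using hi[of i] hi[of n] \<tau>[of i n] neg_inverse_less[of "\<tau> i - z 0" "\<tau> n - z 0"]
            by (auto simp: T_def)
        qed simp
        also have "\<dots> < T j" by (simp add: T_def True)
        finally show ?thesis .
      qed (use main ij in \<open>auto simp: T_def\<close>)
    qed
    have \<zeta>_inc: "\<zeta> i < \<zeta> j" if "i < j" "j < n" for i j
      unfolding \<zeta>_def using z[of "Suc i" "Suc j"] z[of 0 "Suc i"] that by (intro neg_inverse_less) auto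
    define N where "N j k = (if k = 0 then if j < m' then 1 else 0
      else two_sided \<beta> m' T (\<lambda>k. \<zeta> (k - 1)) j k)" for j k
    have "detf (Suc n) (two_sided \<beta> m \<tau> z) = detf (Suc n) (\<lambda>j k.
        \<bar>\<tau> j - z 0\<bar> powr \<beta> * (if k = 0 then 1 else (z k - z 0) powr \<beta>) * N j k)"
    proof (rule detf_cong)
      fix j k assume j: "j < Suc n" and k: "k < Suc n"
      let ?d = "\<tau> j - z 0"
      show "two_sided \<beta> m \<tau> z j k =
        \<bar>\<tau> j - z 0\<bar> powr \<beta> * (if k = 0 then 1 else (z k - z 0) powr \<beta>) * N j k"
      proof (cases k)
        case 0
        then show ?thesis
          using lo[of j] hi[of j] j by (cases "j < m'") (auto simp: two_sided_def N_def tpow_of_nonneg)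
      next
        case (Suc k')
        define e where "e = z k - z 0"
        have e: "e > 0" using z[of 0 k] k Suc by (simp add: e_def)
        have \<zeta>: "\<zeta> k' = - 1 / e" by (simp add: \<zeta>_def e_def Suc)
        have split: "tpow \<beta> (\<bar>?d\<bar> * e * u) = \<bar>?d\<bar> powr \<beta> * e powr \<beta> * tpow \<beta> u" for u
          using e by (subst tpow_mult) (auto simp: powr_mult)
        have "?d * T j = - 1" using ne[OF j] j by (simp add: T_def)
        moreover have "e * \<zeta> k' = - 1" using e by (simp add: \<zeta>)
        moreover have "?d * e * (T j - \<zeta> k') = e * (?d * T j) - ?d * (e * \<zeta> k')"
          by (simp add: algebra_simps)
        ultimately have "?d * e * (T j - \<zeta> k') = ?d - e" by simp
        \<comment> \<open>A negative \<open>\<tau> j - z 0\<close> reverses the sign of the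
          difference and so turns a right row into a left one.\<close>
        then have key: "?d * e * (T j - \<zeta> k') = \<tau> j - z k" by (simp add: e_def)
        have "two_sided \<beta> m \<tau> z j k = \<bar>?d\<bar> powr \<beta> * e powr \<beta> * two_sided \<beta> m' T (\<lambda>k. \<zeta> (k - 1)) j k"
        proof (cases "j < m'")
          case True
          from lo[OF True] show ?thesis
          proof
            assume h: "j < m \<and> \<tau> j > z 0"
            then have "\<tau> j - z k = \<bar>?d\<bar> * e * (T j - \<zeta> k')"
              using key by simp
            then show ?thesis using True h Suc split by (simp add: two_sided_def)
          next
            assume h: "m \<le> j \<and> \<tau> j < z 0"
            then have "z k - \<tau> j = \<bar>?d\<bar> * e * (T j - \<zeta> k')"
              using key by (simp add: algebra_simps)
            then show ?thesis using True h Suc split by (simp add: two_sided_def)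
          qed
        next
          case False
          then have h: "m \<le> j \<and> \<tau> j > z 0" using hi[of j] j by simp
          then have "z k - \<tau> j = \<bar>?d\<bar> * e * (\<zeta> k' - T j)"
            using key by (simp add: algebra_simps)
          then show ?thesis using False h Suc split by (simp add: two_sided_def)
        qed
        then show ?thesis by (simp add: N_def Suc e_def)
      qed
    qed
    also have "\<dots> = (\<Prod>j<Suc n. \<bar>\<tau> j - z 0\<bar> powr \<beta>) *
        (\<Prod>k<Suc n. if k = 0 then 1 else (z k - z 0) powr \<beta>) * detf (Suc n) N"
      by (rule detf_scale)
    finally have factored: "detf (Suc n) (two_sided \<beta> m \<tau> z) = (\<Prod>j<Suc n. \<bar>\<tau> j - z 0\<bar> powr \<beta>) *
        (\<Prod>k<Suc n. if k = 0 then 1 else (z k - z 0) powr \<beta>) * detf (Suc n) N" .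
    \<comment> \<open>The groups are subtracted in opposite order; the choice of endpoints and the
      sign in \<open>F\<close> write both as \<open>F j k (u j) - F j k (l j)\<close> with
      \<open>l j < u j\<close>.\<close>
    define l where "l j = (if Suc j < m' then T j else T (Suc j))" for j
    define u where "u j = (if Suc j < m' then T (Suc j) else T (Suc (Suc j)))" for j
    define F where "F j k t = (if Suc j < m' then tpow \<beta> (t - \<zeta> k) else - tpow \<beta> (\<zeta> k - t))" for j k t
    have last: "N (Suc n) (Suc k) = 0" if "k < n" for k
    proof -
      have "\<zeta> k < 0" using z[of 0 "Suc k"] that by (simp add: \<zeta>_def)
      moreover have "T (Suc n) > 0" by (simp add: T_def)
      ultimately show ?thesis using m'_le by (simp add: N_def two_sided_def)
    qed
    \<comment> \<open>Columns beyond \<open>n\<close> are cleared so that the outside row is zero at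
      every column index.\<close>
    have "detf (Suc n) N = detf (Suc n) (\<lambda>j k. if k \<le> n then N j k else 0)"
      by (rule detf_cong) auto
    also have "\<dots> = detf n (\<lambda>j k. if Suc j < m' then (if Suc k \<le> n then N (Suc j) (Suc k) else 0)
          - (if Suc k \<le> n then N j (Suc k) else 0)
          else (if Suc k \<le> n then N (Suc j) (Suc k) else 0) - (if Suc k \<le> n then N (Suc (Suc j)) (Suc k) else 0))"
      by (rule detf_step_column) (use False m'_le last in \<open>auto simp: N_def\<close>)
    also have "\<dots> = detf n (\<lambda>j k. F j k (u j) - F j k (l j))"
      by (rule detf_cong) (auto simp: N_def F_def u_def l_def two_sided_def)
    also have "\<dots> \<ge> 0"
    proof (rule detf_difference_nonneg[where S = "\<zeta> ` {..<n}" and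
          F' = "\<lambda>j k t. \<beta> * (if Suc j < m' then tpow (\<beta> - 1) (t - \<zeta> k) else tpow (\<beta> - 1) (\<zeta> k - t))"])
      show "l j < u j" if "j < n" for j
        using that m'_le by (auto simp: l_def u_def intro!: T_inc)
      show "continuous_on {l j..u j} (F j k)" for j k
        unfolding F_def using continuous_on_tpow_diff[OF \<open>\<beta> > 0\<close>] by (cases "Suc j < m'") auto
      show "(F j k has_real_derivative
          \<beta> * (if Suc j < m' then tpow (\<beta> - 1) (t - \<zeta> k) else tpow (\<beta> - 1) (\<zeta> k - t))) (at t)"
        if "k < n" "t \<notin> \<zeta> ` {..<n}" for j k t
      proof -
        have "t \<noteq> \<zeta> k" using that by auto
        from has_real_derivative_tpow_diff[OF this] show ?thesis
          unfolding F_def by (cases "Suc j < m'") auto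
      qed
      fix t assume t: "\<And>j. j < n \<Longrightarrow> l j < t j \<and> t j < u j"
      \<comment> \<open>The pivot row belonged to the left group, which shrinks to
        \<open>m' - 1\<close> rows; the order survives because \<open>u i \<le> l j\<close>.\<close>
      have "detf n (two_sided (\<beta> - 1) (m' - 1) t \<zeta>) \<ge> 0"
      proof (rule IH)
        fix i j assume ij: "i < j" "j < n" and side: "j < m' - 1 \<or> m' - 1 \<le> i"
        have "u i \<le> l j"
        proof (cases "Suc j < m'")
          case True
          then show ?thesis using ij T_inc[of "Suc i" j] by (cases "Suc i = j") (auto simp: u_def l_def)
        next
          case False
          then show ?thesis using ij side T_inc[of "Suc (Suc i)" "Suc j"] m'_le
            by (cases "Suc i = j") (auto simp: u_def l_def)
        qed
        then show "t i < t j" using t[of i] t[of j] ij by simp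
      qed (use \<zeta>_inc in auto)
      moreover have "detf n (\<lambda>j k. \<beta> * (if Suc j < m' then tpow (\<beta> - 1) (t j - \<zeta> k)
          else tpow (\<beta> - 1) (\<zeta> k - t j))) = \<beta> ^ n * detf n (two_sided (\<beta> - 1) (m' - 1) t \<zeta>)"
        using detf_scale[of n "\<lambda>_. \<beta>" "\<lambda>_. 1" "two_sided (\<beta> - 1) (m' - 1) t \<zeta>"]
        by (auto simp: two_sided_def less_diff_conv)
      ultimately show "detf n (\<lambda>j k. \<beta> * (if Suc j < m' then tpow (\<beta> - 1) (t j - \<zeta> k)
          else tpow (\<beta> - 1) (\<zeta> k - t j))) \<ge> 0"
        using \<open>\<beta> > 0\<close> by simp
    qed simp
    finally have "detf (Suc n) N \<ge> 0" .
    then show ?thesis unfolding factored by (intro mult_nonneg_nonneg prod_nonneg) auto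
  qed
qed

text \<open>Size and exponent drop together, so the bound on \<beta> survives the pivot step.
  Coincidences \<open>\<tau> j = z 0\<close> are avoided by moving \<open>z 0\<close> slightly to
  the left, and continuity for \<open>\<beta> > 0\<close> passes to the limit.\<close>

lemma detf_two_sided_nonneg:
  assumes "\<beta> > real n - 1"
    and "\<And>i j. i < j \<Longrightarrow> j < Suc n \<Longrightarrow> j < m \<or> m \<le> i \<Longrightarrow> \<tau> i < \<tau> j"
    and "\<And>i j. i < j \<Longrightarrow> j < Suc n \<Longrightarrow> z i < z j"
  shows "detf (Suc n) (two_sided \<beta> m \<tau> z) \<ge> 0"
  using assms
proof (induction n arbitrary: \<beta> m \<tau> z)
  case 0
  show ?case by (simp add: two_sided_def)
next
  case (Suc n)
  have \<beta>: "\<beta> > 0" using Suc.prems(1) by simp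
  have lim: "((\<lambda>e. detf (Suc (Suc n)) (two_sided \<beta> m \<tau> (z(0 := z 0 - e))))
      \<longlongrightarrow> detf (Suc (Suc n)) (two_sided \<beta> m \<tau> z)) (at_right 0)"
  proof (rule detf_tendsto)
    fix j k
    have "((\<lambda>e. (z(0 := z 0 - e)) k) \<longlongrightarrow> z k) (at_right 0)"
      by (cases "k = 0") (auto intro!: tendsto_eq_intros)
    then show "((\<lambda>e. two_sided \<beta> m \<tau> (z(0 := z 0 - e)) j k) \<longlongrightarrow> two_sided \<beta> m \<tau> z j k) (at_right 0)"
      unfolding two_sided_def
      by (cases "j < m") (auto intro!: isCont_tendsto_compose[OF isCont_tpow[OF \<beta>]] tendsto_diff)
  qed
  have "eventually (\<lambda>e. \<forall>j\<in>{..<Suc (Suc n)}. \<tau> j \<noteq> z 0 - e) (at_right 0)"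
  proof (rule eventually_ball_finite)
    show "\<forall>j\<in>{..<Suc (Suc n)}. eventually (\<lambda>e. \<tau> j \<noteq> z 0 - e) (at_right 0)"
    proof
      fix j
      show "eventually (\<lambda>e. \<tau> j \<noteq> z 0 - e) (at_right 0)"
      proof (cases "z 0 - \<tau> j > 0")
        case True
        have "eventually (\<lambda>e. e < z 0 - \<tau> j) (at_right 0)"
          by (rule order_tendstoD(2)[OF tendsto_ident_at True])
        then show ?thesis by eventually_elim simp
      next
        case False
        show ?thesis
          using eventually_at_right_less[of 0] by eventually_elim (use False in auto)
      qed
    qed
  qed simp
  moreover have "eventually (\<lambda>e. e > 0) (at_right (0::real))"
    by (rule eventually_at_right_less)
  ultimately have "eventually (\<lambda>e. detf (Suc (Suc n)) (two_sided \<beta> m \<tau> (z(0 := z 0 - e))) \<ge> 0) (at_right 0)"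
  proof eventually_elim
    case (elim e)
    show ?case
    proof (rule detf_two_sided_step[OF _ \<beta>])
      fix m \<tau> z
      assume "\<And>i j. i < j \<Longrightarrow> j < Suc n \<Longrightarrow> j < m \<or> m \<le> i \<Longrightarrow> \<tau> i < (\<tau> j :: real)"
        "\<And>i j. i < j \<Longrightarrow> j < Suc n \<Longrightarrow> z i < (z j :: real)"
      then show "detf (Suc n) (two_sided (\<beta> - 1) m \<tau> z) \<ge> 0"
        using Suc.prems(1) by (intro Suc.IH) auto
    next
      fix i j assume "i < j" "j < Suc (Suc n)"
      then show "(z(0 := z 0 - e)) i < (z(0 := z 0 - e)) j"
        using Suc.prems(3)[of i j] elim by auto
    qed (use Suc.prems elim in auto)
  qed
  then show ?case
    by (rule tendsto_lowerbound[OF lim]) simp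
qed

text \<open>The first column is zero, or rows 0 and 1 are both identically 1, or the first column is
  the first unit vector and can be deleted along with the first row.\<close>

lemma detf_step_function_nonneg:
  fixes \<tau> z :: "nat \<Rightarrow> real"
  assumes "\<And>i j. i < j \<Longrightarrow> j < n \<Longrightarrow> \<tau> i < \<tau> j" "\<And>i j. i < j \<Longrightarrow> j < n \<Longrightarrow> z i < z j"
  shows "detf n (\<lambda>j k. if \<tau> j < z k then 1 else 0) \<ge> 0"
  using assms
proof (induction n arbitrary: \<tau> z)
  case (Suc n)
  let ?M = "\<lambda>j k. if \<tau> j < z k then 1 else 0 :: real"
  show ?case
  proof (cases "\<tau> 0 < z 0")
    case False
    have "detf (Suc n) ?M = 0"
    proof (rule detf_zero_col[of 0])
      fix j assume "j < Suc n"
      then have "\<tau> 0 \<le> \<tau> j" using Suc.prems(1)[of 0 j] by (cases j) auto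
      then show "?M j 0 = 0" using False by simp
    qed simp
    then show ?thesis by simp
  next
    case True
    show ?thesis
    proof (cases "n > 0 \<and> \<tau> 1 < z 0")
      case True
      have "detf (Suc n) ?M = 0"
      proof (rule detf_eq_rows[of 0 _ 1])
        fix k assume "k < Suc n"
        then have "z 0 \<le> z k" using Suc.prems(2)[of 0 k] by (cases k) auto
        then show "?M 0 k = ?M 1 k" using True \<open>\<tau> 0 < z 0\<close> by simp
      qed (use True in auto)
      then show ?thesis by simp
    next
      case False
      have "detf (Suc n) ?M = detf n (\<lambda>j k. ?M (Suc j) (Suc k))"
      proof (rule detf_unit_col)
        fix j assume "j < n"
        then have "\<tau> 1 \<le> \<tau> (Suc j)" using Suc.prems(1)[of 1 "Suc j"] by (cases j) auto
        then show "?M (Suc j) 0 = 0" using False \<open>j < n\<close> by auto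
      qed (use True in auto)
      also have "\<dots> \<ge> 0" by (rule Suc.IH) (use Suc.prems in auto)
      finally show ?thesis .
    qed
  qed
qed simp

text \<open>For rows of one kind, differences against an extra zero row lower the exponent at
  constant size, so \<open>d\<close> may be small compared with \<open>n\<close>. The induction ends
  at step functions.\<close>

lemma detf_truncated_power_nonneg:
  fixes \<tau> z :: "nat \<Rightarrow> real"
  assumes "\<And>i j. i < j \<Longrightarrow> j < n \<Longrightarrow> \<tau> i < \<tau> j" "\<And>i j. i < j \<Longrightarrow> j < n \<Longrightarrow> z i < z j"
  shows "detf n (\<lambda>j k. tpow (real d) (z k - \<tau> j)) \<ge> 0"
  using assms(1)
proof (induction d arbitrary: \<tau>)
  case 0
  have "(\<lambda>j k. tpow (real 0) (z k - \<tau> j)) = (\<lambda>j k. if \<tau> j < z k then 1 else 0)"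
    by (auto simp: fun_eq_iff tpow_def max_def)
  then show ?case
    using detf_step_function_nonneg[of n \<tau> z] 0 assms(2) by simp
next
  case (Suc d)
  \<comment> \<open>A point beyond the last \<open>\<tau>\<close> and all \<open>z\<close>, whose
    row would be zero.\<close>
  define b where "b = Max (insert (\<tau> (n - 1)) (z ` {..<n})) + 1"
  define T where "T j = (if j < n then \<tau> j else b)" for j
  have b: "\<tau> (n - 1) < b" "\<And>k. k < n \<Longrightarrow> z k < b"
    unfolding b_def by (auto intro!: less_add_one[THEN le_less_trans[rotated]] Max_ge)
  have T_inc: "T i < T j" if "i < j" "j \<le> n" for i j
  proof (cases "j < n")
    case False
    have "\<tau> i \<le> \<tau> (n - 1)" using Suc.prems[of i "n - 1"] that by (cases "i < n - 1"; cases "i = n - 1") auto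
    then show ?thesis using False that b(1) by (simp add: T_def)
  qed (use that Suc.prems in \<open>auto simp: T_def\<close>)
  define M where "M j k = (if k < n then tpow (real (Suc d)) (z k - T j) else 0)" for j k
  define F where "F k t = - tpow (real (Suc d)) (z k - t)" for k t
  have "detf n (\<lambda>j k. tpow (real (Suc d)) (z k - \<tau> j)) = detf n M"
    by (rule detf_cong) (auto simp: M_def T_def)
  also have "\<dots> = detf n (\<lambda>j k. M j k - M (Suc j) k)"
    by (rule detf_row_differences) (use b(2) in \<open>auto simp: M_def T_def less_imp_le\<close>)
  also have "\<dots> = detf n (\<lambda>j k. F k (T (Suc j)) - F k (T j))"
    by (rule detf_cong) (auto simp: M_def F_def)
  also have "\<dots> \<ge> 0"
  proof (rule detf_difference_nonneg[where S = "z ` {..<n}" and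
        F' = "\<lambda>j k t. real (Suc d) * tpow (real d) (z k - t)"])
    show "T j < T (Suc j)" if "j < n" for j using T_inc[of j "Suc j"] that by simp
    show "continuous_on {T j..T (Suc j)} (F k)" for j k
      unfolding F_def by (rule continuous_on_tpow_diff) simp
    show "(F k has_real_derivative real (Suc d) * tpow (real d) (z k - t)) (at t)"
      if "k < n" "t \<notin> z ` {..<n}" for k t
      using has_real_derivative_tpow_diff(2)[of t "z k" "real (Suc d)"] that
      by (auto simp: F_def [abs_def])
    fix t assume t: "\<And>j. j < n \<Longrightarrow> T j < t j \<and> t j < T (Suc j)"
    have "detf n (\<lambda>j k. tpow (real d) (z k - t j)) \<ge> 0"
    proof (rule Suc.IH)
      fix i j assume ij: "i < j" "j < n"
      then have "T (Suc i) \<le> T j" using T_inc[of "Suc i" j] by (cases "Suc i = j") auto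
      then show "t i < t j" using t[of i] t[of j] ij by simp
    qed
    then show "detf n (\<lambda>j k. real (Suc d) * tpow (real d) (z k - t j)) \<ge> 0"
      using detf_scale[of n "\<lambda>_. real (Suc d)" "\<lambda>_. 1" "\<lambda>j k. tpow (real d) (z k - t j)"] by simp
  qed simp
  finally show ?case .
qed

section \<open>The Jain--Karlin--Schoenberg kernel\<close>

lemma inc_mono: "inc X r x \<Longrightarrow> X \<subseteq> Y \<Longrightarrow> inc Y r x"
  by (auto simp: inc_def)

lemma TN_kernel_mono:
  "TN_kernel p X Y K \<Longrightarrow> X' \<subseteq> X \<Longrightarrow> Y' \<subseteq> Y \<Longrightarrow> TN_kernel p X' Y' K"
  unfolding TN_kernel_def using inc_mono by blast

lemma TN_kernel_transpose: "TN_kernel p X Y (\<lambda>x y. K y x) \<longleftrightarrow> TN_kernel p Y X K"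
  unfolding TN_kernel_def using detf_transpose[of _ "\<lambda>j k. K (_ j) (_ k)"] by metis

lemma kpow_JKS_commute: "(\<lambda>x y. kpow JKS \<alpha> y x) = kpow JKS \<alpha>"
  by (simp add: fun_eq_iff kpow_def JKS_def mult.commute)

lemma kpow_JKS_pos: "1 + x * y > 0 \<Longrightarrow> kpow JKS \<alpha> x y = (1 + x * y) powr \<alpha>"
  by (simp add: kpow_def JKS_def)

lemma kpow_JKS_two_sided:
  assumes "x \<noteq> 0"
  shows "kpow JKS \<alpha> x y =
    \<bar>x\<bar> powr \<alpha> * (if x < 0 then tpow \<alpha> (- 1 / x - y) else tpow \<alpha> (y - (- 1 / x)))"
proof -
  have "1 + x * y = \<bar>x\<bar> * (if x < 0 then - 1 / x - y else y - (- 1 / x))"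
    using assms by (auto simp: field_simps)
  then have "kpow JKS \<alpha> x y = tpow \<alpha> (\<bar>x\<bar> * (if x < 0 then - 1 / x - y else y - (- 1 / x)))"
    by (simp add: kpow_def JKS_def tpow_def)
  then show ?thesis by (simp add: tpow_mult)
qed

lemma detf_JKS_two_sided:
  assumes "\<And>j. j < r \<Longrightarrow> (if j < m then x j < 0 else x j > 0)"
  shows "detf r (\<lambda>j k. kpow JKS \<alpha> (x j) (y k)) =
    (\<Prod>j<r. \<bar>x j\<bar> powr \<alpha>) * detf r (two_sided \<alpha> m (\<lambda>j. - 1 / x j) y)"
proof -
  have "detf r (\<lambda>j k. kpow JKS \<alpha> (x j) (y k)) =
      detf r (\<lambda>j k. \<bar>x j\<bar> powr \<alpha> * 1 * two_sided \<alpha> m (\<lambda>j. - 1 / x j) y j k)"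
  proof (rule detf_cong)
    fix j k assume "j < r"
    then show "kpow JKS \<alpha> (x j) (y k) = \<bar>x j\<bar> powr \<alpha> * 1 * two_sided \<alpha> m (\<lambda>j. - 1 / x j) y j k"
      using assms[of j] by (cases "j < m") (simp_all add: kpow_JKS_two_sided two_sided_def)
  qed
  also have "\<dots> = (\<Prod>j<r. \<bar>x j\<bar> powr \<alpha>) * detf r (two_sided \<alpha> m (\<lambda>j. - 1 / x j) y)"
    by (subst detf_scale) simp
  finally show ?thesis .
qed

text \<open>Only the row with \<open>x j = 0\<close> is moved: its entries stay near \<open>1\<close>, so the limit is valid
  even for \<open>\<alpha> = 0\<close>, where the kernel is discontinuous.\<close>
lemma detf_JKS_nonneg_of_nonzero:
  assumes "s \<noteq> 0" "\<And>e. e > 0 \<Longrightarrow> s * e \<in> X" "inc X r x"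
    and "\<And>x. inc X r x \<Longrightarrow> (\<And>j. j < r \<Longrightarrow> x j \<noteq> 0) \<Longrightarrow> detf r (\<lambda>j k. kpow JKS \<alpha> (x j) (y k)) \<ge> 0"
  shows "detf r (\<lambda>j k. kpow JKS \<alpha> (x j) (y k)) \<ge> 0"
proof (cases "\<exists>j<r. x j = 0")
  case False
  then show ?thesis using assms(3,4) by auto
next
  case True
  then obtain j0 where j0: "j0 < r" "x j0 = 0" by blast
  \<comment> \<open>The sign of \<open>s\<close> chooses the side to which the zero is moved, so
    that a half-line \<open>X\<close> is not left.\<close>
  let ?x = "\<lambda>e. x(j0 := s * e)"
  have lim0: "((\<lambda>e. s * e) \<longlongrightarrow> 0) (at_right 0)"
    by (auto intro!: tendsto_eq_intros)
  have lim: "((\<lambda>e. detf r (\<lambda>j k. kpow JKS \<alpha> (?x e j) (y k))) \<longlongrightarrow>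
      detf r (\<lambda>j k. kpow JKS \<alpha> (x j) (y k))) (at_right 0)"
  proof (rule detf_tendsto)
    fix j k
    have "((\<lambda>e. max (1 + s * e * y k) 0 powr \<alpha>) \<longlongrightarrow> max (1 + 0 * y k) 0 powr \<alpha>) (at_right 0)"
      by (intro tendsto_powr tendsto_max tendsto_add tendsto_mult lim0 tendsto_const) simp
    then show "((\<lambda>e. kpow JKS \<alpha> (?x e j) (y k)) \<longlongrightarrow> kpow JKS \<alpha> (x j) (y k)) (at_right 0)"
      by (cases "j = j0") (simp_all add: kpow_def JKS_def j0)
  qed
  have "eventually (\<lambda>e. \<forall>i\<in>{..<r}. (i < j0 \<longrightarrow> x i < s * e) \<and> (j0 < i \<longrightarrow> s * e < x i)) (at_right 0)"
  proof (rule eventually_ball_finite)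
    show "\<forall>i\<in>{..<r}. eventually (\<lambda>e. (i < j0 \<longrightarrow> x i < s * e) \<and> (j0 < i \<longrightarrow> s * e < x i)) (at_right 0)"
    proof
      fix i assume i: "i \<in> {..<r}"
      \<comment> \<open>By strict monotonicity the other entries are nonzero with signs given by
        their positions, so a small shift keeps the order.\<close>
      consider "i < j0" "x i < 0" | "i = j0" | "j0 < i" "0 < x i"
        using assms(3) i j0 unfolding inc_def by (metis lessThan_iff linorder_neqE_nat)
      then show "eventually (\<lambda>e. (i < j0 \<longrightarrow> x i < s * e) \<and> (j0 < i \<longrightarrow> s * e < x i)) (at_right 0)"
      proof cases
        case 1
        show ?thesis using order_tendstoD(1)[OF lim0 1(2)] by eventually_elim (use 1 in auto)
      next
        case 3
        show ?thesis using order_tendstoD(2)[OF lim0 3(2)] by eventually_elim (use 3 in auto)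
      qed simp
    qed
  qed simp
  moreover have "eventually (\<lambda>e. e > 0) (at_right (0::real))"
    by (rule eventually_at_right_less)
  ultimately have "eventually (\<lambda>e. detf r (\<lambda>j k. kpow JKS \<alpha> (?x e j) (y k)) \<ge> 0) (at_right 0)"
  proof eventually_elim
    case (elim e)
    show ?case
    proof (rule assms(4))
      show "inc X r (?x e)"
        using assms(2)[of e] assms(3) elim j0 unfolding inc_def by auto
      fix j assume "j < r"
      then show "?x e j \<noteq> 0"
        using elim assms(1,3) j0 unfolding inc_def
        by (cases j j0 rule: linorder_cases) (auto, metis less_irrefl, metis less_irrefl)
    qed
  qed
  then show ?thesis by (rule tendsto_lowerbound[OF lim]) simp
qed

section \<open>Nonnegative minors of the kernel\<close>

lemma neg_inverse_inc:
  fixes x :: "nat \<Rightarrow> real"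
  assumes "inc X r x" "i < j" "j < r" "x j < 0 \<or> 0 < x i"
  shows "- 1 / x i < - 1 / x j"
  using assms by (intro neg_inverse_less) (auto simp: inc_def)

lemma detf_JKS_nonneg_of_less:
  assumes "\<alpha> > real n - 1" "inc UNIV (Suc n) x" "inc UNIV (Suc n) y"
  shows "detf (Suc n) (\<lambda>j k. kpow JKS \<alpha> (x j) (y k)) \<ge> 0"
proof (rule detf_JKS_nonneg_of_nonzero[of 1, OF _ _ assms(2)])
  fix x :: "nat \<Rightarrow> real"
  assume x: "inc UNIV (Suc n) x" and nz: "\<And>j. j < Suc n \<Longrightarrow> x j \<noteq> 0"
  \<comment> \<open>The nonzero increasing \<open>x\<close> are negative before \<open>m\<close> and
    positive from \<open>m\<close> on, and \<open>- 1 / x\<close> increases within each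
    group.\<close>
  define m where "m = (LEAST j. j = Suc n \<or> x j > 0)"
  have m: "m = Suc n \<or> x m > 0"
    unfolding m_def by (rule LeastI[of "\<lambda>j. j = Suc n \<or> x j > 0" "Suc n"]) simp
  have neg: "x j < 0" if "j < Suc n" "j < m" for j
    using not_less_Least[OF that(2)[unfolded m_def]] nz[OF that(1)] by auto
  have pos: "x j > 0" if "j < Suc n" "m \<le> j" for j
    using m x that unfolding inc_def by (cases "m = j") (auto, smt (verit) le_neq_implies_less)
  have "detf (Suc n) (two_sided \<alpha> m (\<lambda>j. - 1 / x j) y) \<ge> 0"
  proof (rule detf_two_sided_nonneg[OF assms(1)])
    fix i j assume "i < j" "j < Suc n" "j < m \<or> m \<le> i"
    then show "- 1 / x i < - 1 / x j"
      using neg[of j] pos[of i] by (intro neg_inverse_inc[OF x]) auto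
  qed (use assms(3) in \<open>auto simp: inc_def\<close>)
  moreover have "detf (Suc n) (\<lambda>j k. kpow JKS \<alpha> (x j) (y k)) =
      (\<Prod>j<Suc n. \<bar>x j\<bar> powr \<alpha>) * detf (Suc n) (two_sided \<alpha> m (\<lambda>j. - 1 / x j) y)"
    by (rule detf_JKS_two_sided) (use neg pos in auto)
  ultimately show "detf (Suc n) (\<lambda>j k. kpow JKS \<alpha> (x j) (y k)) \<ge> 0"
    by (simp add: prod_nonneg del: prod.lessThan_Suc)
qed auto

text \<open>The endpoint \<open>\<alpha> = r - 2\<close> is reached by letting the exponent
  decrease. Where the kernel vanishes its powers are constantly 0, so this works even at
  \<open>\<alpha> = 0\<close>.\<close>

lemma detf_JKS_nonneg:
  assumes "\<alpha> \<ge> real r - 2" "1 \<le> r" "inc UNIV r x" "inc UNIV r y"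
  shows "detf r (\<lambda>j k. kpow JKS \<alpha> (x j) (y k)) \<ge> 0"
proof -
  have "((\<lambda>e. detf r (\<lambda>j k. kpow JKS (\<alpha> + e) (x j) (y k))) \<longlongrightarrow>
      detf r (\<lambda>j k. kpow JKS \<alpha> (x j) (y k))) (at_right 0)"
  proof (rule detf_tendsto)
    fix j k
    show "((\<lambda>e. kpow JKS (\<alpha> + e) (x j) (y k)) \<longlongrightarrow> kpow JKS \<alpha> (x j) (y k)) (at_right 0)"
    proof (cases "JKS (x j) (y k) = 0")
      case False
      have "((\<lambda>e. \<alpha> + e) \<longlongrightarrow> \<alpha>) (at_right 0)"
        by (auto intro!: tendsto_eq_intros)
      then show ?thesis unfolding kpow_def by (rule tendsto_powr[OF tendsto_const _ False])
    qed (simp add: kpow_def)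
  qed
  moreover have "eventually (\<lambda>e. detf r (\<lambda>j k. kpow JKS (\<alpha> + e) (x j) (y k)) \<ge> 0) (at_right 0)"
    using eventually_at_right_less[of "0 :: real"]
  proof eventually_elim
    case (elim e)
    obtain n where "r = Suc n" using assms(2) by (cases r) auto
    then show ?case using detf_JKS_nonneg_of_less[of n "\<alpha> + e" x y] assms elim by simp
  qed
  ultimately show ?thesis by (rule tendsto_lowerbound) simp
qed

lemma TN_kernel_JKS: "\<alpha> \<ge> real p - 2 \<Longrightarrow> TN_kernel p UNIV UNIV (kpow JKS \<alpha>)"
  unfolding TN_kernel_def by (auto intro!: detf_JKS_nonneg)

text \<open>With \<open>x\<close> on one side of 0 all rows are of one kind, so the result on
  truncated powers applies at every size.\<close>

lemma detf_JKS_nat_nonneg: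
  assumes "inc {0..} r x \<or> inc {..0} r x" "inc UNIV r y"
  shows "detf r (\<lambda>j k. kpow JKS (real d) (x j) (y k)) \<ge> 0"
proof -
  have y: "\<And>i j. i < j \<Longrightarrow> j < r \<Longrightarrow> y i < y j" using assms(2) by (simp add: inc_def)
  from assms(1) show ?thesis
  proof
    assume "inc {0..} r x"
    then show ?thesis
    proof (rule detf_JKS_nonneg_of_nonzero[of 1, rotated 2])
      fix x :: "nat \<Rightarrow> real"
      assume x: "inc {0..} r x" and nz: "\<And>j. j < r \<Longrightarrow> x j \<noteq> 0"
      have pos: "x j > 0" if "j < r" for j
        using x nz[OF that] that by (auto simp: inc_def order_less_le)
      have "detf r (\<lambda>j k. kpow JKS (real d) (x j) (y k)) =
          (\<Prod>j<r. \<bar>x j\<bar> powr real d) * detf r (two_sided (real d) 0 (\<lambda>j. - 1 / x j) y)"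
        by (rule detf_JKS_two_sided) (use pos in auto)
      also have "detf r (two_sided (real d) 0 (\<lambda>j. - 1 / x j) y) =
          detf r (\<lambda>j k. tpow (real d) (y k - (- 1 / x j)))"
        by (rule detf_cong) (simp add: two_sided_def)
      also have "(\<Prod>j<r. \<bar>x j\<bar> powr real d) * \<dots> \<ge> 0"
        by (intro mult_nonneg_nonneg prod_nonneg detf_truncated_power_nonneg neg_inverse_inc[OF x] y)
           (use pos in auto)
      finally show "detf r (\<lambda>j k. kpow JKS (real d) (x j) (y k)) \<ge> 0" .
    qed auto
  next
    assume "inc {..0} r x"
    then show ?thesis
    proof (rule detf_JKS_nonneg_of_nonzero[of "- 1", rotated 2])
      fix x :: "nat \<Rightarrow> real"
      assume x: "inc {..0} r x" and nz: "\<And>j. j < r \<Longrightarrow> x j \<noteq> 0"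
      have neg: "x j < 0" if "j < r" for j
        using x nz[OF that] that by (auto simp: inc_def order_less_le)
      have "detf r (\<lambda>j k. kpow JKS (real d) (x j) (y k)) =
          (\<Prod>j<r. \<bar>x j\<bar> powr real d) * detf r (two_sided (real d) r (\<lambda>j. - 1 / x j) y)"
        by (rule detf_JKS_two_sided) (use neg in auto)
      also have "detf r (two_sided (real d) r (\<lambda>j. - 1 / x j) y) =
          detf r (\<lambda>j k. tpow (real d) (- 1 / x j - y k))"
        by (rule detf_cong) (simp add: two_sided_def)
      \<comment> \<open>Transposition exchanges the roles: \<open>y\<close> now acts as
        \<open>\<tau>\<close>, and \<open>- 1 / x\<close> as \<open>z\<close>.\<close>
      also have "\<dots> = detf r (\<lambda>j k. tpow (real d) (- 1 / x k - y j))"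
        by (rule detf_transpose)
      also have "(\<Prod>j<r. \<bar>x j\<bar> powr real d) * \<dots> \<ge> 0"
        by (intro mult_nonneg_nonneg prod_nonneg detf_truncated_power_nonneg neg_inverse_inc[OF x] y)
           (use neg in auto)
      finally show "detf r (\<lambda>j k. kpow JKS (real d) (x j) (y k)) \<ge> 0" .
    qed auto
  qed
qed

lemma TN_kernel_JKS_nat:
  assumes "I \<subseteq> {0..} \<or> I \<subseteq> {..0}"
  shows "TN_kernel p I UNIV (kpow JKS (real d))"
  unfolding TN_kernel_def using assms by (auto intro!: detf_JKS_nat_nonneg dest: inc_mono)

section \<open>Failure for nonintegral exponents\<close>

lemma not_nat_between:
  assumes "\<alpha> \<ge> 0" "\<alpha> \<notin> \<nat>" "\<alpha> < real p - 2"
  obtains m where "real m < \<alpha>" "\<alpha> < real m + 1" "m + 3 \<le> p"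
proof
  \<comment> \<open>With \<open>m\<close> the integer part of \<alpha>, \<open>m + 3\<close> is the
    first size with a negative coefficient; it is at most \<open>p\<close> since
    \<open>\<alpha> < p - 2\<close>.\<close>
  let ?m = "nat \<lfloor>\<alpha>\<rfloor>"
  have m: "real ?m \<le> \<alpha>" "\<alpha> < real ?m + 1" using assms(1) by linarith+
  moreover have "\<alpha> \<noteq> real ?m" using assms(2) by (metis of_nat_in_Nats)
  ultimately show "real ?m < \<alpha>" "\<alpha> < real ?m + 1" by auto
  show "?m + 3 \<le> p" using m(1) assms(3) by linarith
qed

lemma not_TN_kernel_JKS:
  assumes "\<alpha> \<ge> 0" "\<alpha> \<notin> \<nat>" "\<alpha> < real p - 2"
    and "is_interval I" "a \<in> I" "b \<in> I" "a < b" "I \<subseteq> {0..} \<or> I \<subseteq> {..0}"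
  shows "\<not> TN_kernel p I UNIV (kpow JKS \<alpha>)"
proof
  assume TN: "TN_kernel p I UNIV (kpow JKS \<alpha>)"
  obtain m where m: "real m < \<alpha>" "\<alpha> < real m + 1" "m + 3 \<le> p"
    using not_nat_between[OF assms(1-3)] .
  define r where "r = m + 3"
  \<comment> \<open>The \<open>x\<close> are equally spaced in \<open>I\<close> and the
    \<open>y\<close> are taken on the same side of 0, so \<open>x j * y k \<ge> 0\<close> and all
    entries are positive.\<close>
  define x where "x j = a + (b - a) * (real j / real r)" for j
  define y where "y k = (if I \<subseteq> {0..} then real k else real k - real r)" for k
  have "x j \<in> I" if "j < r" for j
  proof (rule mem_is_interval_1_I[OF assms(4-6)])
    have "(b - a) * (real j / real r) \<le> (b - a) * 1"
      using assms(7) that by (intro mult_left_mono) auto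
    then show "a \<le> x j" "x j \<le> b" using assms(7) by (auto simp: x_def)
  qed
  moreover have "x i < x j" if "i < j" "j < r" for i j
    using that assms(7) by (simp add: x_def divide_strict_right_mono)
  ultimately have x: "inc I r x" by (simp add: inc_def)
  have y: "inc UNIV r y" by (simp add: inc_def y_def)
  have pos: "1 + x j * y k > 0" if "j < r" "k < r" for j k
  proof -
    have "x j \<in> I" using x that by (simp add: inc_def)
    then have "x j * y k \<ge> 0"
      using assms(8) that by (auto simp: y_def zero_le_mult_iff)
    then show ?thesis by simp
  qed
  have "\<exists>D>0. detf r (\<lambda>j k. (1 + x j * y k) powr \<alpha>) = binom_sign_coeff r \<alpha> * D"
    by (rule detf_power_sign) (use x y pos in \<open>auto simp: inc_def\<close>)
  then have "detf r (\<lambda>j k. (1 + x j * y k) powr \<alpha>) < 0"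
    using binom_sign_coeff_neg[OF m(1,2)] by (auto simp: r_def mult_neg_pos)
  moreover have "detf r (\<lambda>j k. kpow JKS \<alpha> (x j) (y k)) = detf r (\<lambda>j k. (1 + x j * y k) powr \<alpha>)"
    by (rule detf_cong) (simp add: kpow_JKS_pos pos)
  moreover have "detf r (\<lambda>j k. kpow JKS \<alpha> (x j) (y k)) \<ge> 0"
    using TN x y m(3) unfolding TN_kernel_def by (simp add: r_def)
  ultimately show False by linarith
qed

lemma TN_kernel_JKS_interval_iff:
  assumes "\<alpha> \<ge> 0" "is_interval I" "a \<in> I" "b \<in> I" "a < b" "I \<subseteq> {0..} \<or> I \<subseteq> {..0}"
  shows "TN_kernel p I UNIV (kpow JKS \<alpha>) \<longleftrightarrow> \<alpha> \<in> \<nat> \<or> \<alpha> \<ge> real p - 2"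
proof
  show "TN_kernel p I UNIV (kpow JKS \<alpha>)" if "\<alpha> \<in> \<nat> \<or> \<alpha> \<ge> real p - 2"
    using that
  proof
    assume "\<alpha> \<in> \<nat>"
    then obtain d where "\<alpha> = real d" by (auto elim: Nats_cases)
    then show ?thesis using TN_kernel_JKS_nat[OF assms(6)] by simp
  next
    assume "\<alpha> \<ge> real p - 2"
    then show ?thesis using TN_kernel_JKS TN_kernel_mono by blast
  qed
qed (use not_TN_kernel_JKS[OF assms(1) _ _ assms(2-6)] in force)

text \<open>Selecting rows and columns keeps both sequences increasing, so the sign of a minor
  depends only on its order and \<alpha>.\<close>

lemma minor_power_sign:
  fixes x y :: "nat \<Rightarrow> real"
  assumes "inc UNIV p x" "inc UNIV p y" "\<forall>j<p. \<forall>k<p. 1 + x j * y k > 0"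
    and "inc_idx p r a" "inc_idx p r b"
  obtains D where "D > 0" "detf r (\<lambda>j k. (1 + x (a j) * y (b k)) powr \<alpha>) = binom_sign_coeff r \<alpha> * D"
proof -
  have "\<exists>D>0. detf r (\<lambda>j k. (1 + x (a j) * y (b k)) powr \<alpha>) = binom_sign_coeff r \<alpha> * D"
    by (rule detf_power_sign) (use assms in \<open>auto simp: inc_def inc_idx_def\<close>)
  then show ?thesis using that by blast
qed

theorem theoremC:
  fixes p :: nat and \<alpha> :: real
  assumes "p \<ge> 2" and "\<alpha> \<ge> 0"
  shows
    "(\<alpha> \<ge> real p - 2 \<longrightarrow> TN_kernel p UNIV UNIV (kpow JKS \<alpha>))
   \<and> (TN_kernel p UNIV UNIV (kpow JKS \<alpha>) \<longrightarrow> \<alpha> \<in> \<nat> \<or> \<alpha> \<ge> real p - 2)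
   \<and> (\<forall>x y. inc UNIV p x \<and> inc UNIV p y \<and> (\<forall>j<p. \<forall>k<p. 1 + x j * y k > 0) \<longrightarrow>
        (\<alpha> > real p - 2 \<longrightarrow> TP_matrix p (\<lambda>j k. (1 + x j * y k) powr \<alpha>))
      \<and> (\<alpha> \<in> \<nat> \<and> \<alpha> \<le> real p - 2 \<longrightarrow> TN_matrix p (\<lambda>j k. (1 + x j * y k) powr \<alpha>))
      \<and> (0 < \<alpha> \<and> \<alpha> < real p - 2 \<and> \<alpha> \<notin> \<int> \<longrightarrow>
           \<not> TN_matrix p (\<lambda>j k. (1 + x j * y k) powr \<alpha>)))
   \<and> (\<forall>I :: real set. is_interval I \<and> (\<exists>a\<in>I. \<exists>b\<in>I. a < b) \<and>
        (I \<subseteq> {0..} \<or> I \<subseteq> {..0}) \<longrightarrow>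
        (TN_kernel p I UNIV (kpow JKS \<alpha>) \<longleftrightarrow> \<alpha> \<in> \<nat> \<or> \<alpha> \<ge> real p - 2)
      \<and> (TN_kernel p UNIV I (kpow JKS \<alpha>) \<longleftrightarrow> \<alpha> \<in> \<nat> \<or> \<alpha> \<ge> real p - 2)
      \<and> (\<alpha> \<in> \<nat> \<longrightarrow> TN_kernel_all I UNIV (kpow JKS \<alpha>) \<and> TN_kernel_all UNIV I (kpow JKS \<alpha>)))"
    (is "?full \<and> ?necessary \<and> ?matrices \<and> ?intervals")
proof (intro conjI)
  show ?full by (simp add: TN_kernel_JKS)
  have swap: "TN_kernel q UNIV I (kpow JKS \<alpha>) \<longleftrightarrow> TN_kernel q I UNIV (kpow JKS \<alpha>)" for q I
    using TN_kernel_transpose[of q UNIV I "kpow JKS \<alpha>"] by (simp add: kpow_JKS_commute)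
  show ?necessary
  proof
    assume "TN_kernel p UNIV UNIV (kpow JKS \<alpha>)"
    then have "TN_kernel p {0..1} UNIV (kpow JKS \<alpha>)" by (rule TN_kernel_mono) auto
    then show "\<alpha> \<in> \<nat> \<or> \<alpha> \<ge> real p - 2"
      using TN_kernel_JKS_interval_iff[of \<alpha> "{0..1}" 0 1 p] assms(2) by (simp add: is_interval_cc)
  qed
  show ?matrices
  proof (intro allI impI)
    fix x y :: "nat \<Rightarrow> real"
    assume "inc UNIV p x \<and> inc UNIV p y \<and> (\<forall>j<p. \<forall>k<p. 1 + x j * y k > 0)"
    then have "inc UNIV p x" "inc UNIV p y" "\<forall>j<p. \<forall>k<p. 1 + x j * y k > 0"
      by auto
    note minor = minor_power_sign[OF this]
    show "(\<alpha> > real p - 2 \<longrightarrow> TP_matrix p (\<lambda>j k. (1 + x j * y k) powr \<alpha>))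
      \<and> (\<alpha> \<in> \<nat> \<and> \<alpha> \<le> real p - 2 \<longrightarrow> TN_matrix p (\<lambda>j k. (1 + x j * y k) powr \<alpha>))
      \<and> (0 < \<alpha> \<and> \<alpha> < real p - 2 \<and> \<alpha> \<notin> \<int> \<longrightarrow>
           \<not> TN_matrix p (\<lambda>j k. (1 + x j * y k) powr \<alpha>))"
    proof (intro conjI impI)
      assume \<alpha>: "\<alpha> > real p - 2"
      show "TP_matrix p (\<lambda>j k. (1 + x j * y k) powr \<alpha>)"
        unfolding TP_matrix_def
      proof (intro allI impI)
        fix r a b assume r: "1 \<le> r \<and> r \<le> p \<and> inc_idx p r a \<and> inc_idx p r b"
        obtain D where "D > 0"
          "detf r (\<lambda>j k. (1 + x (a j) * y (b k)) powr \<alpha>) = binom_sign_coeff r \<alpha> * D"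
          using minor[of r a b \<alpha>] r by blast
        moreover have "binom_sign_coeff r \<alpha> > 0"
          by (rule binom_sign_coeff_pos) (use \<alpha> r in linarith)
        ultimately show "detf r (\<lambda>j k. (1 + x (a j) * y (b k)) powr \<alpha>) > 0" by simp
      qed
    next
      assume "\<alpha> \<in> \<nat> \<and> \<alpha> \<le> real p - 2"
      then obtain d where d: "\<alpha> = real d" by (auto elim: Nats_cases)
      \<comment> \<open>The coefficients are positive up to order \<open>d + 1\<close> and zero from
        \<open>d + 2\<close> on.\<close>
      have "binom_sign_coeff r \<alpha> \<ge> 0" for r
        using binom_sign_coeff_zero[of d r] binom_sign_coeff_pos[of r "real d"]
        by (cases "d + 2 \<le> r") (auto simp: d less_imp_le)
      then show "TN_matrix p (\<lambda>j k. (1 + x j * y k) powr \<alpha>)"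
        unfolding TN_matrix_def by (metis minor less_imp_le mult_nonneg_nonneg)
    next
      assume \<alpha>: "0 < \<alpha> \<and> \<alpha> < real p - 2 \<and> \<alpha> \<notin> \<int>"
      then have "\<alpha> \<notin> \<nat>" using Nats_subset_Ints by blast
      then obtain m where m: "real m < \<alpha>" "\<alpha> < real m + 1" "m + 3 \<le> p"
        using not_nat_between[of \<alpha> p] \<alpha> assms(2) by blast
      \<comment> \<open>The leading principal minor of order \<open>m + 3\<close> is negative for
        every admissible \<open>x\<close> and \<open>y\<close>.\<close>
      have idx: "inc_idx p (m + 3) (\<lambda>i. i)" using m(3) by (simp add: inc_idx_def)
      obtain D where "D > 0"
        "detf (m + 3) (\<lambda>j k. (1 + x j * y k) powr \<alpha>) = binom_sign_coeff (m + 3) \<alpha> * D"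
        using minor[OF idx idx] .
      then have "detf (m + 3) (\<lambda>j k. (1 + x j * y k) powr \<alpha>) < 0"
        using binom_sign_coeff_neg[OF m(1,2)] by (simp add: mult_neg_pos)
      moreover have "detf (m + 3) (\<lambda>j k. (1 + x j * y k) powr \<alpha>) \<ge> 0"
        if "TN_matrix p (\<lambda>j k. (1 + x j * y k) powr \<alpha>)"
        using that[unfolded TN_matrix_def, rule_format, of "m + 3" "\<lambda>i. i" "\<lambda>i. i"] idx m(3) by simp
      ultimately show "\<not> TN_matrix p (\<lambda>j k. (1 + x j * y k) powr \<alpha>)" by linarith
    qed
  qed
  show ?intervals
  proof (intro allI impI)
    fix I :: "real set"
    assume I: "is_interval I \<and> (\<exists>a\<in>I. \<exists>b\<in>I. a < b) \<and> (I \<subseteq> {0..} \<or> I \<subseteq> {..0})"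
    \<comment> \<open>Stated for every order \<open>q\<close>: for natural \<alpha> the right side
      always holds, which gives total nonnegativity.\<close>
    then have iff: "TN_kernel q I UNIV (kpow JKS \<alpha>) \<longleftrightarrow> \<alpha> \<in> \<nat> \<or> \<alpha> \<ge> real q - 2" for q
      using TN_kernel_JKS_interval_iff[OF assms(2)] by blast
    then show "(TN_kernel p I UNIV (kpow JKS \<alpha>) \<longleftrightarrow> \<alpha> \<in> \<nat> \<or> \<alpha> \<ge> real p - 2)
      \<and> (TN_kernel p UNIV I (kpow JKS \<alpha>) \<longleftrightarrow> \<alpha> \<in> \<nat> \<or> \<alpha> \<ge> real p - 2)
      \<and> (\<alpha> \<in> \<nat> \<longrightarrow> TN_kernel_all I UNIV (kpow JKS \<alpha>) \<and> TN_kernel_all UNIV I (kpow JKS \<alpha>))"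
      by (simp add: swap TN_kernel_all_def)
  qed
qed

end
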